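(* Let $\Psi_h^0\in H_h$ and $F^m\in H_h$ for any $m\geq 1$. Consider the splitting scheme: for any $m\geq 1$, $$ i\hbar\,\frac{\breve{\Psi}^m-\Psi^{m-1}}{\tau_m/2}=(V-\tilde V)\,\frac{\breve{\Psi}^m+\Psi^{m-1}}{2}\quad\text{on }\omega_{h,\infty},$$ $$ i\hbar\, s_N\frac{\widetilde{\Psi}^m-\breve{\Psi}^m}{\tau_m}=-c_{\hbar}\Delta_{hN}\frac{\widetilde{\Psi}^m+\breve{\Psi}^m}{2}+s_N\Bigl(\tilde V\,\frac{\widetilde{\Psi}^m+\breve{\Psi}^m}{2}\Bigr)+F^m\quad\text{on }\omega_{h,\infty},$$ $$ i\hbar\,\frac{\Psi^m-\widetilde{\Psi}^m}{\tau_m/2}=(V-\tilde V)\,\frac{\Psi^m+\widetilde{\Psi}^m}{2}\quad\text{on }\omega_{h,\infty},$$ with the boundary conditions $\breve{\Psi}^m|_{\Gamma_{h,\infty}}=0$, $\widetilde{\Psi}^m|_{\Gamma_{h,\infty}}=0$, $\Psi^m|_{\Gamma_{h,\infty}}=0$ for $m\ge 1$ and the initial condition $\Psi^0=\Psi^0_h$ on $\overline{\omega}_{h,\infty}$. Then there exists a unique solution to this scheme such that $\Psi^m\in H_h$ for any $m\geq 0$, and the following $L^2$-stability bound holds: $$ \max_{0\leq m\leq M}\|\Psi^m\|_{H_h}\leq\|\Psi^0_h\|_{H_h}+\frac{6}{\hbar}\sum_{m=1}^M\|F^m\|_{H_h}\tau_m\quad\text{for any } M\geq 1.$$ Moreover,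 in the particular case $F=0$ (i.e. $F^m=0$ for all $m\ge1$), the following mass conservation law holds: $$ \|\Psi^m\|_{H_h}^2=\|\Psi^0_h\|_{H_h}^2\quad\text{for any } m\geq 1.$$
   Context: Constants: $\hbar>0$, $m_0>0$, $c_\hbar:=\hbar^2/(2m_0)$; $i$ is the imaginary unit. $Y>0$, $X>X_0>0$. The potential $V(x,y)$ is a given real function on the semi-infinite strip $(0,\infty)\times(0,Y)$ with $V(x,y)=V_\infty$ (a constant) for $x\ge X_0$, $0<y<Y$. The auxiliary potential $\tilde V=\tilde V(x)$ is real, depends only on $x$, and satisfies $\tilde V(x)=V_\infty$ for $x\ge X_0$. Space mesh: $x_j=jh_x$, $j\ge0$, $h_x=X/J$, with $h_x\le X-X_0$; $y_k=kh_y$, $0\le k\le K$, $h_y=Y/K$; $h=(h_x,h_y)$. $\overline\omega_{h,\infty}=\{(x_j,y_k): j\ge0,\ 0\le k\le K\}$, $\omega_{h,\infty}=\{(x_j,y_k): j\ge1,\ 1\le k\le K-1\}$, $\Gamma_{h,\infty}=\overline\omega_{h,\infty}\setminus\omega_{h,\infty}$. Time mesh (possibly non-uniform): $0=t_0<t_1<\dots<t_m<\dots$, $t_m\to\infty$, $\tau_m=t_m-t_{m-1}$. The superscript $m$ denotes the time level. Difference operators, for mesh functions $W_{j,k}$: $\partial_x\bar\partial_xW_{j,k}=(W_{j+1,k}-2W_{j,k}+W_{j-1,k})/h_x^2$, $\partial_y\bar\partial_yW_{j,k}=(W_{j,k+1}-2W_{j,k}+W_{j,k-1})/h_y^2$;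 $s_{Nx}=I+\frac{h_x^2}{12}\partial_x\bar\partial_x$, $s_{Ny}=I+\frac{h_y^2}{12}\partial_y\bar\partial_y$; $s_N=I+\frac{h_x^2}{12}\partial_x\bar\partial_x+\frac{h_y^2}{12}\partial_y\bar\partial_y$; $\Delta_{hN}=s_{Ny}\partial_x\bar\partial_x+s_{Nx}\partial_y\bar\partial_y$. $H_h$ is the Hilbert space of mesh functions $W:\overline\omega_{h,\infty}\to\mathbb C$ with $W|_{\Gamma_{h,\infty}}=0$ and $\sum_{j=1}^\infty\sum_{k=1}^{K-1}|W_{j,k}|^2<\infty$, with inner product $(U,W)_{H_h}=\sum_{j=1}^\infty\sum_{k=1}^{K-1}U_{j,k}W_{j,k}^*h_xh_y$ (where $^*$ is complex conjugation) and associated norm $\|\cdot\|_{H_h}$. *)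

theory Defs
  imports "HOL-Analysis.Analysis"
begin

text \<open>
  A mesh function is represented by its values \<open>W j k\<close> at the nodes \<open>(x\<^sub>j, y\<^sub>k) = (j h\<^sub>x, k h\<^sub>y)\<close>,
  and mesh regions by sets of index pairs. Only the values with \<open>k \<le> K\<close> are meaningful, so mesh
  functions are compared by \<open>mesh_eq\<close> rather than by equality of HOL functions.
\<close>

type_synonym mesh_fun = "nat \<Rightarrow> nat \<Rightarrow> complex"

definition mesh :: "nat \<Rightarrow> (nat \<times> nat) set" where
  "mesh K = {(j, k). k \<le> K}"

definition mesh_interior :: "nat \<Rightarrow> (nat \<times> nat) set" where
  "mesh_interior K = {(j, k). 1 \<le> j \<and> 1 \<le> k \<and> k < K}"

definition mesh_boundary :: "nat \<Rightarrow> (nat \<times> nat) set" where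
  "mesh_boundary K = mesh K - mesh_interior K"

definition mesh_eq :: "nat \<Rightarrow> mesh_fun \<Rightarrow> mesh_fun \<Rightarrow> bool" where
  "mesh_eq K U W \<longleftrightarrow> (\<forall>(j, k) \<in> mesh K. U j k = W j k)"

definition zero_on_boundary :: "nat \<Rightarrow> mesh_fun \<Rightarrow> bool" where
  "zero_on_boundary K W \<longleftrightarrow> (\<forall>(j, k) \<in> mesh_boundary K. W j k = 0)"

definition H_h :: "nat \<Rightarrow> mesh_fun set" where
  "H_h K = {W. zero_on_boundary K W \<and>
               (\<lambda>j. \<Sum>k = 1..K - 1. (cmod (W j k))\<^sup>2) summable_on {1..}}"

definition H_inner :: "real \<Rightarrow> real \<Rightarrow> nat \<Rightarrow> mesh_fun \<Rightarrow> mesh_fun \<Rightarrow> complex" where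
  "H_inner hx hy K U W =
     (\<Sum>\<^sub>\<infinity>j\<in>{1..}. \<Sum>k = 1..K - 1. U j k * cnj (W j k) * complex_of_real hx * complex_of_real hy)"

definition H_norm :: "real \<Rightarrow> real \<Rightarrow> nat \<Rightarrow> mesh_fun \<Rightarrow> real" where
  "H_norm hx hy K W = sqrt (Re (H_inner hx hy K W W))"

text \<open>
  The second differences contain truncated subtraction, hence are correct only for \<open>j \<ge> 1\<close>,
  respectively \<open>k \<ge> 1\<close>. The scheme is imposed on the interior nodes only, and evaluating \<open>s_N\<close> and
  \<open>Delta_hN\<close> there never uses the spurious values.
\<close>

definition dxx :: "real \<Rightarrow> mesh_fun \<Rightarrow> mesh_fun" where
  "dxx hx W = (\<lambda>j k. (W (j + 1) k - 2 * W j k + W (j - 1) k) / complex_of_real (hx\<^sup>2))"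

definition dyy :: "real \<Rightarrow> mesh_fun \<Rightarrow> mesh_fun" where
  "dyy hy W = (\<lambda>j k. (W j (k + 1) - 2 * W j k + W j (k - 1)) / complex_of_real (hy\<^sup>2))"

definition s_Nx :: "real \<Rightarrow> mesh_fun \<Rightarrow> mesh_fun" where
  "s_Nx hx W = (\<lambda>j k. W j k + complex_of_real (hx\<^sup>2 / 12) * dxx hx W j k)"

definition s_Ny :: "real \<Rightarrow> mesh_fun \<Rightarrow> mesh_fun" where
  "s_Ny hy W = (\<lambda>j k. W j k + complex_of_real (hy\<^sup>2 / 12) * dyy hy W j k)"

definition s_N :: "real \<Rightarrow> real \<Rightarrow> mesh_fun \<Rightarrow> mesh_fun" where
  "s_N hx hy W = (\<lambda>j k. W j k + complex_of_real (hx\<^sup>2 / 12) * dxx hx W j k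
                              + complex_of_real (hy\<^sup>2 / 12) * dyy hy W j k)"

definition Delta_hN :: "real \<Rightarrow> real \<Rightarrow> mesh_fun \<Rightarrow> mesh_fun" where
  "Delta_hN hx hy W = (\<lambda>j k. s_Ny hy (dxx hx W) j k + s_Nx hx (dyy hy W) j k)"

definition c_hbar :: "real \<Rightarrow> real \<Rightarrow> real" where
  "c_hbar hbar m0 = hbar\<^sup>2 / (2 * m0)"

definition tau :: "(nat \<Rightarrow> real) \<Rightarrow> nat \<Rightarrow> real" where
  "tau t m = t m - t (m - 1)"

text \<open>
  The first and third substeps of the splitting are the same map with different data:
  a half step of length \<open>dt / 2\<close> from \<open>A\<close> to \<open>B\<close> with the potential \<open>V - Vt\<close>.
\<close>

definition potential_step ::
  "real \<Rightarrow> real \<Rightarrow> real \<Rightarrow> nat \<Rightarrow> (real \<Rightarrow> real \<Rightarrow> real) \<Rightarrow> (real \<Rightarrow> real)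
    \<Rightarrow> real \<Rightarrow> mesh_fun \<Rightarrow> mesh_fun \<Rightarrow> bool" where
  "potential_step hbar hx hy K V Vt dt A B \<longleftrightarrow>
     (\<forall>(j, k) \<in> mesh_interior K.
        \<i> * complex_of_real hbar * ((B j k - A j k) / complex_of_real (dt / 2)) =
        complex_of_real (V (real j * hx) (real k * hy) - Vt (real j * hx)) * ((B j k + A j k) / 2))"

definition kinetic_step ::
  "real \<Rightarrow> real \<Rightarrow> real \<Rightarrow> real \<Rightarrow> nat \<Rightarrow> (real \<Rightarrow> real)
    \<Rightarrow> real \<Rightarrow> mesh_fun \<Rightarrow> mesh_fun \<Rightarrow> mesh_fun \<Rightarrow> bool" where
  "kinetic_step hbar m0 hx hy K Vt dt f A B \<longleftrightarrow>
     (\<forall>(j, k) \<in> mesh_interior K.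
        \<i> * complex_of_real hbar * s_N hx hy (\<lambda>j k. (B j k - A j k) / complex_of_real dt) j k =
        - complex_of_real (c_hbar hbar m0) * Delta_hN hx hy (\<lambda>j k. (B j k + A j k) / 2) j k
        + s_N hx hy (\<lambda>j k. complex_of_real (Vt (real j * hx)) * ((B j k + A j k) / 2)) j k
        + f j k)"

text \<open>
  \<open>Pb\<close>, \<open>Pt\<close>, \<open>P\<close> stand for the breve, tilde and plain \<open>\<Psi>\<close>; \<open>Pb 0\<close> and \<open>Pt 0\<close> are not part of the
  scheme.
\<close>

definition splitting_scheme ::
  "real \<Rightarrow> real \<Rightarrow> real \<Rightarrow> real \<Rightarrow> nat \<Rightarrow> (real \<Rightarrow> real \<Rightarrow> real) \<Rightarrow> (real \<Rightarrow> real)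
    \<Rightarrow> (nat \<Rightarrow> real) \<Rightarrow> (nat \<Rightarrow> mesh_fun) \<Rightarrow> mesh_fun
    \<Rightarrow> (nat \<Rightarrow> mesh_fun) \<Rightarrow> (nat \<Rightarrow> mesh_fun) \<Rightarrow> (nat \<Rightarrow> mesh_fun) \<Rightarrow> bool" where
  "splitting_scheme hbar m0 hx hy K V Vt t F P0 Pb Pt P \<longleftrightarrow>
     (\<forall>m\<ge>1. potential_step hbar hx hy K V Vt (tau t m) (P (m - 1)) (Pb m) \<and>
            kinetic_step hbar m0 hx hy K Vt (tau t m) (F m) (Pb m) (Pt m) \<and>
            potential_step hbar hx hy K V Vt (tau t m) (Pt m) (P m) \<and>
            zero_on_boundary K (Pb m) \<and> zero_on_boundary K (Pt m) \<and> zero_on_boundary K (P m)) \<and>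
     mesh_eq K (P 0) P0"

end

theory Submission
  imports Defs
begin

text \<open>
  On \<open>H_h\<close> the operators \<open>-(h\<^sub>x\<^sup>2/12) \<partial>\<^sub>x\<partial>\<^sub>x\<close> and \<open>-(h\<^sub>y\<^sup>2/12) \<partial>\<^sub>y\<partial>\<^sub>y\<close> are self-adjoint, commute and are
  bounded by \<open>1/3\<close>, so \<open>s_N \<ge> 1/3\<close> is invertible with inverse bounded by \<open>3\<close> and commutes with
  \<open>\<Delta>_hN\<close>. Applying the inverse of \<open>s_N\<close> turns the second substep into a Crank--Nicolson step
  \<open>\<i>\<hbar>(B - A)/\<tau> = L(A + B)/2 + g\<close> with the bounded self-adjoint operator
  \<open>L = -c_hbar s_N\<^sup>-\<^sup>1 \<Delta>_hN + Vt\<close> and \<open>norm g \<le> 3 norm F\<close>. The operator \<open>1 + \<i> (\<tau>/2\<hbar>) L\<close> is coercive,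
  which gives unique solvability by Lax--Milgram; pairing the equation with \<open>A + B\<close> gives
  \<open>\<bar>norm B - norm A\<bar> \<le> (\<tau>/\<hbar>) norm g\<close>, i.e. stability with the constant \<open>3/\<hbar>\<close> and
  conservation for \<open>F = 0\<close>. The first and third substeps multiply each node value by a unimodular
  Cayley factor.
\<close>

section \<open>The Hilbert space of square-summable families\<close>

typedef 'a ell2 = "{f :: 'a \<Rightarrow> complex. (\<lambda>p. (cmod (f p))\<^sup>2) summable_on UNIV}"
  morphisms coord Abs_ell2
  by (rule exI[of _ "\<lambda>_. 0"]) simp

setup_lifting type_definition_ell2

lemma ell2_eqI: "(\<And>p. coord f p = coord g p) \<Longrightarrow> f = g"
  by (metis coord_inject ext)

lemma summable_coord: "(\<lambda>p. (cmod (coord f p))\<^sup>2) summable_on A"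
  using coord[of f] summable_on_subset[of _ UNIV A] by auto

lemma cmod_add_square_le: "(cmod (a + b))\<^sup>2 \<le> 2 * (cmod a)\<^sup>2 + 2 * (cmod b)\<^sup>2"
proof -
  have "(cmod (a + b))\<^sup>2 \<le> (cmod a + cmod b)\<^sup>2"
    by (intro power_mono norm_triangle_ineq) auto
  also have "\<dots> \<le> 2 * (cmod a)\<^sup>2 + 2 * (cmod b)\<^sup>2"
    using zero_le_power2[of "cmod a - cmod b"] by (simp add: power2_eq_square algebra_simps)
  finally show ?thesis .
qed

lemma square_summable_add:
  assumes "(\<lambda>p. (cmod (f p))\<^sup>2) summable_on A" "(\<lambda>p. (cmod (g p))\<^sup>2) summable_on A"
  shows "(\<lambda>p. (cmod (f p + g p))\<^sup>2) summable_on A"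
proof (rule summable_on_comparison_test)
  show "(\<lambda>p. 2 * (cmod (f p))\<^sup>2 + 2 * (cmod (g p))\<^sup>2) summable_on A"
    using assms by (intro summable_on_add summable_on_cmult_right)
qed (auto intro: cmod_add_square_le)

instantiation ell2 :: (type) real_vector
begin

lift_definition zero_ell2 :: "'a ell2" is "\<lambda>_. 0"
  by simp

lift_definition plus_ell2 :: "'a ell2 \<Rightarrow> 'a ell2 \<Rightarrow> 'a ell2" is "\<lambda>f g p. f p + g p"
  by (rule square_summable_add)

lift_definition uminus_ell2 :: "'a ell2 \<Rightarrow> 'a ell2" is "\<lambda>f p. - f p"
  by simp

lift_definition minus_ell2 :: "'a ell2 \<Rightarrow> 'a ell2 \<Rightarrow> 'a ell2" is "\<lambda>f g p. f p - g p"
  subgoal for f g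
    using square_summable_add[of f UNIV "\<lambda>p. - g p"] by simp
  done

lift_definition scaleR_ell2 :: "real \<Rightarrow> 'a ell2 \<Rightarrow> 'a ell2" is "\<lambda>r f p. r *\<^sub>R f p"
  by (simp add: power_mult_distrib summable_on_cmult_right)

instance
  by standard (transfer; force simp: algebra_simps)+

end

lemma coord_simps [simp]:
  "coord 0 p = 0"
  "coord (f + g) p = coord f p + coord g p"
  "coord (f - g) p = coord f p - coord g p"
  "coord (- f) p = - coord f p"
  "coord (r *\<^sub>R f) p = complex_of_real r * coord f p"
  by (transfer; simp add: scaleR_conv_of_real)+

lemma summable_inner:
  assumes "(\<lambda>p. (cmod (f p))\<^sup>2) summable_on A" "(\<lambda>p. (cmod (g p))\<^sup>2) summable_on A"
  shows "(\<lambda>p. f p \<bullet> g p) summable_on A"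
proof -
  have "(\<lambda>p. norm (f p \<bullet> g p)) summable_on A"
  proof (rule summable_on_comparison_test)
    show "(\<lambda>p. (cmod (f p))\<^sup>2 + (cmod (g p))\<^sup>2) summable_on A"
      using assms by (rule summable_on_add)
    fix p
    have "norm (f p \<bullet> g p) \<le> cmod (f p) * cmod (g p)"
      by (simp add: Cauchy_Schwarz_ineq2)
    also have "\<dots> \<le> 2 * cmod (f p) * cmod (g p)"
      by simp
    also have "\<dots> \<le> (cmod (f p))\<^sup>2 + (cmod (g p))\<^sup>2"
      by (rule sum_squares_bound)
    finally show "norm (f p \<bullet> g p) \<le> (cmod (f p))\<^sup>2 + (cmod (g p))\<^sup>2" .
  qed auto
  then show ?thesis by (rule abs_summable_summable)
qed

lemma summable_coord_inner: "(\<lambda>p. coord f p \<bullet> coord g p) summable_on A"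
  by (intro summable_inner summable_coord)

instantiation ell2 :: (type) real_inner
begin

text \<open>On complex numbers \<open>\<bullet>\<close> is the real part of
  \<open>z * cnj u\<close>, so this is the real part of the usual complex inner product and induces
  the same norm.\<close>

definition inner_ell2 :: "'a ell2 \<Rightarrow> 'a ell2 \<Rightarrow> real" where
  "inner_ell2 f g = (\<Sum>\<^sub>\<infinity>p. coord f p \<bullet> coord g p)"

definition norm_ell2 :: "'a ell2 \<Rightarrow> real" where
  "norm_ell2 f = sqrt (f \<bullet> f)"

definition dist_ell2 :: "'a ell2 \<Rightarrow> 'a ell2 \<Rightarrow> real" where
  "dist_ell2 f g = norm (f - g)"

definition sgn_ell2 :: "'a ell2 \<Rightarrow> 'a ell2" where
  "sgn_ell2 f = f /\<^sub>R norm f"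

definition uniformity_ell2 :: "('a ell2 \<times> 'a ell2) filter" where
  "uniformity_ell2 = (INF e\<in>{0<..}. principal {(f, g). dist f g < e})"

definition open_ell2 :: "'a ell2 set \<Rightarrow> bool" where
  "open_ell2 U = (\<forall>f\<in>U. eventually (\<lambda>(f', g). f' = f \<longrightarrow> g \<in> U) uniformity)"

instance
proof
  fix f g h :: "'a ell2" and r :: real
  show "f \<bullet> g = g \<bullet> f"
    by (simp add: inner_ell2_def inner_commute)
  show "(f + g) \<bullet> h = f \<bullet> h + g \<bullet> h"
    by (simp add: inner_ell2_def inner_add_left infsum_add summable_coord_inner)
  have "(\<Sum>\<^sub>\<infinity>p. coord (r *\<^sub>R f) p \<bullet> coord g p) = (\<Sum>\<^sub>\<infinity>p. r * (coord f p \<bullet> coord g p))"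
    by (simp flip: scaleR_conv_of_real)
  then show "(r *\<^sub>R f) \<bullet> g = r * (f \<bullet> g)"
    by (simp add: inner_ell2_def infsum_cmult_right')
  show "0 \<le> f \<bullet> f"
    by (auto simp: inner_ell2_def intro!: infsum_nonneg)
  have "f = 0" if "f \<bullet> f = 0"
  proof (rule ell2_eqI)
    fix p
    have "coord f p \<bullet> coord f p = 0"
      by (rule nonneg_infsum_le_0D[OF _ summable_coord_inner[of f f UNIV]])
        (use that in \<open>auto simp: inner_ell2_def\<close>)
    then show "coord f p = coord 0 p" by simp
  qed
  then show "f \<bullet> f = 0 \<longleftrightarrow> f = 0"
    by (auto simp: inner_ell2_def)
qed (simp_all add: norm_ell2_def dist_ell2_def sgn_ell2_def uniformity_ell2_def open_ell2_def)

end

section \<open>Coordinates, pointwise limits and completeness\<close>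

lemma norm_ell2_square: "(norm f)\<^sup>2 = (\<Sum>\<^sub>\<infinity>p. (cmod (coord f p))\<^sup>2)"
  by (simp add: power2_norm_eq_inner inner_ell2_def)

lemma cmod_coord_le: "cmod (coord f p) \<le> norm f"
proof -
  have "(\<Sum>q\<in>{p}. (cmod (coord f q))\<^sup>2) \<le> (\<Sum>\<^sub>\<infinity>q. (cmod (coord f q))\<^sup>2)"
    by (rule finite_sum_le_infsum) (auto simp: summable_coord)
  then have "(cmod (coord f p))\<^sup>2 \<le> (norm f)\<^sup>2"
    by (simp add: norm_ell2_square)
  then show ?thesis
    by (rule power2_le_imp_le) simp
qed

lemma square_sum_coord_le: "finite A \<Longrightarrow> (\<Sum>p\<in>A. (cmod (coord f p))\<^sup>2) \<le> (norm f)\<^sup>2"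
  unfolding norm_ell2_square by (rule finite_sum_le_infsum) (auto simp: summable_coord)

text \<open>A Fatou argument: every finite partial sum of squares passes to the limit and stays
  below \<open>C\<^sup>2\<close>, which bounds the whole sum.\<close>

lemma ell2_bounded_pointwise_limit:
  assumes lim: "\<And>p. (\<lambda>n. coord (X n) p) \<longlonglongrightarrow> l p"
    and bound: "\<forall>\<^sub>F n in sequentially. norm (X n) \<le> C"
  shows "\<exists>f. (\<forall>p. coord f p = l p) \<and> norm f \<le> C"
proof -
  have C: "0 \<le> C"
    using eventually_happens'[OF sequentially_bot bound] norm_ge_zero order_trans by blast
  have fin: "(\<Sum>p\<in>A. (cmod (l p))\<^sup>2) \<le> C\<^sup>2" if "finite A" for A
  proof (rule tendsto_upperbound)
    show "(\<lambda>n. \<Sum>p\<in>A. (cmod (coord (X n) p))\<^sup>2) \<longlonglongrightarrow> (\<Sum>p\<in>A. (cmod (l p))\<^sup>2)"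
      by (intro tendsto_intros lim)
    show "\<forall>\<^sub>F n in sequentially. (\<Sum>p\<in>A. (cmod (coord (X n) p))\<^sup>2) \<le> C\<^sup>2"
      using bound
      by eventually_elim
        (rule order_trans[OF square_sum_coord_le[OF that]], rule power_mono, auto)
  qed simp
  have summable: "(\<lambda>p. (cmod (l p))\<^sup>2) summable_on UNIV"
    by (rule nonneg_bdd_above_summable_on) (auto intro!: bdd_aboveI2[where M = "C\<^sup>2"] fin)
  then have coord: "coord (Abs_ell2 l) = l"
    by (simp add: Abs_ell2_inverse)
  have "(norm (Abs_ell2 l))\<^sup>2 \<le> C\<^sup>2"
    unfolding norm_ell2_square coord by (rule infsum_le_finite_sums[OF summable]) (rule fin)
  then have "norm (Abs_ell2 l) \<le> C"
    using C by (rule power2_le_imp_le)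
  with coord show ?thesis by metis
qed

text \<open>Completeness of the complex numbers gives a pointwise limit \<open>l\<close>. The Fatou
  bound for \<open>X m - X n\<close> as m grows puts \<open>l - X n\<close> into \<open>ell2\<close>
  with small norm, which yields both membership of \<open>l\<close> and convergence.\<close>

instance ell2 :: (type) complete_space
proof
  fix X :: "nat \<Rightarrow> 'a ell2"
  assume X: "Cauchy X"
  have "Cauchy (\<lambda>n. coord (X n) p)" for p
  proof (rule metric_CauchyI)
    fix e :: real assume e: "0 < e"
    obtain N where "\<forall>m\<ge>N. \<forall>n\<ge>N. dist (X m) (X n) < e"
      using metric_CauchyD[OF X e] by blast
    then show "\<exists>N. \<forall>m\<ge>N. \<forall>n\<ge>N. dist (coord (X m) p) (coord (X n) p) < e"
      by (metis cmod_coord_le coord_simps(3) dist_norm order_le_less_trans)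
  qed
  then have "\<forall>p. \<exists>l. (\<lambda>n. coord (X n) p) \<longlonglongrightarrow> l"
    by (metis Cauchy_convergent_iff convergent_def)
  then obtain l where l: "\<And>p. (\<lambda>n. coord (X n) p) \<longlonglongrightarrow> l p"
    by metis
  have close: "\<exists>N. \<forall>n\<ge>N. \<exists>g. (\<forall>p. coord g p = l p - coord (X n) p) \<and> norm g \<le> e" if e: "0 < e" for e
  proof -
    obtain N where N: "\<forall>m\<ge>N. \<forall>n\<ge>N. dist (X m) (X n) < e"
      using metric_CauchyD[OF X e] by blast
    have "\<exists>g. (\<forall>p. coord g p = l p - coord (X n) p) \<and> norm g \<le> e" if "N \<le> n" for n
    proof (rule ell2_bounded_pointwise_limit)
      show "(\<lambda>m. coord (X m - X n) p) \<longlonglongrightarrow> l p - coord (X n) p" for p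
        by (simp add: tendsto_diff l)
      show "\<forall>\<^sub>F m in sequentially. norm (X m - X n) \<le> e"
        using eventually_ge_at_top[of N]
        by eventually_elim (use N that in \<open>auto simp: dist_norm intro: less_imp_le\<close>)
    qed
    then show ?thesis by blast
  qed
  obtain n g where g: "\<And>p. coord g p = l p - coord (X n) p"
    using close[of 1] by (metis order_refl zero_less_one)
  have limit: "coord (X n + g) p = l p" for p
    by (simp add: g)
  have "X \<longlonglongrightarrow> X n + g"
  proof (rule metric_LIMSEQ_I)
    fix e :: real assume "0 < e"
    \<comment> \<open>\<open>close\<close> gives only a non-strict bound, so \<open>e / 2\<close>
      supplies the strict one.\<close>
    then obtain N where N: "\<forall>m\<ge>N. \<exists>h. (\<forall>p. coord h p = l p - coord (X m) p) \<and> norm h \<le> e / 2"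
      using close[of "e / 2"] by auto
    have "dist (X m) (X n + g) < e" if m: "N \<le> m" for m
    proof -
      obtain h where h: "\<And>p. coord h p = l p - coord (X m) p" "norm h \<le> e / 2"
        using N m by blast
      have "X n + g - X m = h"
        using limit by (intro ell2_eqI) (simp add: h)
      then have "dist (X m) (X n + g) = norm h"
        by (metis dist_commute dist_norm)
      then show ?thesis
        using h(2) \<open>0 < e\<close> by simp
    qed
    then show "\<exists>N. \<forall>m\<ge>N. dist (X m) (X n + g) < e" by blast
  qed
  then show "convergent X"
    by (auto simp: convergent_def)
qed

section \<open>Crank--Nicolson steps in a Hilbert space\<close>

text \<open>The Lax--Milgram lemma: \<open>x \<mapsto> x - r (T x - g)\<close> is a contraction for small \<open>r > 0\<close>.\<close>

lemma coercive_bij: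
  fixes T :: "'a::{real_inner,complete_space} \<Rightarrow> 'a"
  assumes "bounded_linear T" and "0 < c" and coercive: "\<And>x. c * (norm x)\<^sup>2 \<le> T x \<bullet> x"
  shows "bij T"
proof -
  interpret T: bounded_linear T by fact
  obtain M where M: "\<And>x. norm (T x) \<le> norm x * M" and "0 < M"
    using T.pos_bounded by blast
  \<comment> \<open>Adding \<open>c\<close> to the operator bound guarantees
    \<open>c \<le> B\<close>, hence a nonnegative radicand in \<open>q\<close>.\<close>
  define B where "B = M + c"
  have B: "0 < B" "c \<le> B" "\<And>x. norm (T x) \<le> B * norm x"
    using \<open>0 < M\<close> \<open>0 < c\<close> M unfolding B_def
    by (auto simp: algebra_simps intro: order_trans[OF M])
  \<comment> \<open>This \<open>r\<close> minimises
    \<open>1 - 2 * r * c + r\<^sup>2 * B\<^sup>2\<close>, whose minimum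
    \<open>1 - c\<^sup>2 / B\<^sup>2\<close> is the square of the contraction factor
    \<open>q\<close>.\<close>
  define r where "r = c / B\<^sup>2"
  define q where "q = sqrt (1 - c\<^sup>2 / B\<^sup>2)"
  have "c\<^sup>2 \<le> B\<^sup>2"
    using B \<open>0 < c\<close> by (intro power_mono) auto
  then have sq: "0 \<le> 1 - c\<^sup>2 / B\<^sup>2" "1 - c\<^sup>2 / B\<^sup>2 < 1"
    using B \<open>0 < c\<close> by (auto simp: field_simps)
  then have q: "0 \<le> q" "q < 1"
    by (auto simp: q_def)
  have contract: "norm (x - r *\<^sub>R T x) \<le> q * norm x" for x
  proof (rule power2_le_imp_le)
    have "(norm (T x))\<^sup>2 \<le> (B * norm x)\<^sup>2"
      by (intro power_mono B) auto
    then have "r\<^sup>2 * (norm (T x))\<^sup>2 \<le> r\<^sup>2 * (B\<^sup>2 * (norm x)\<^sup>2)"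
      by (intro mult_left_mono) (auto simp: power_mult_distrib)
    moreover have "r * (c * (norm x)\<^sup>2) \<le> r * (T x \<bullet> x)"
      using \<open>0 < c\<close> by (intro mult_left_mono coercive) (simp add: r_def)
    moreover have "(norm (x - r *\<^sub>R T x))\<^sup>2 = (norm x)\<^sup>2 - 2 * (r * (T x \<bullet> x)) + r\<^sup>2 * (norm (T x))\<^sup>2"
      unfolding power2_norm_eq_inner
      by (simp add: inner_diff_left inner_diff_right inner_commute[of x "T x"] power2_eq_square algebra_simps)
    ultimately have "(norm (x - r *\<^sub>R T x))\<^sup>2
        \<le> (norm x)\<^sup>2 - 2 * (r * (c * (norm x)\<^sup>2)) + r\<^sup>2 * (B\<^sup>2 * (norm x)\<^sup>2)"
      by linarith
    also have "\<dots> = (1 - c\<^sup>2 / B\<^sup>2) * (norm x)\<^sup>2"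
      using B by (simp add: r_def field_simps power2_eq_square)
    also have "\<dots> = (q * norm x)\<^sup>2"
      using sq by (simp add: q_def power_mult_distrib)
    finally show "(norm (x - r *\<^sub>R T x))\<^sup>2 \<le> (q * norm x)\<^sup>2" .
  qed (use q in simp)
  have "r \<noteq> 0"
    using B \<open>0 < c\<close> by (simp add: r_def)
  have "\<exists>!x. T x = g" for g
  proof -
    \<comment> \<open>Since \<open>r \<noteq> 0\<close>, the fixed points of this map are exactly
      the solutions of \<open>T x = g\<close>.\<close>
    have "\<exists>!x. x - r *\<^sub>R (T x - g) = x"
    proof (rule banach_fix_type[OF q], intro allI)
      fix x y
      have "x - r *\<^sub>R (T x - g) - (y - r *\<^sub>R (T y - g)) = (x - y) - r *\<^sub>R T (x - y)"
        by (simp add: T.diff algebra_simps)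
      then show "dist (x - r *\<^sub>R (T x - g)) (y - r *\<^sub>R (T y - g)) \<le> q * dist x y"
        using contract[of "x - y"] unfolding dist_norm by (simp only:)
    qed
    then show ?thesis
      using \<open>r \<noteq> 0\<close> by simp
  qed
  then show ?thesis
    by (simp add: bij_iff)
qed

text \<open>Cauchy-Schwarz against \<open>x\<close>, divided by \<open>norm x\<close>. For positive
  \<open>c\<close> this bounds the inverse of a coercive bijection by \<open>1 / c\<close>.\<close>

lemma coercive_norm_ge:
  assumes "\<And>x. c * (norm x)\<^sup>2 \<le> T x \<bullet> x"
  shows "c * norm (x :: 'a::real_inner) \<le> norm (T x)"
proof (cases "x = 0")
  case False
  have "c * norm x * norm x \<le> norm (T x) * norm x"
    using assms[of x] norm_cauchy_schwarz[of "T x" x] by (simp add: power2_eq_square)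
  with False show ?thesis by simp
qed simp

section \<open>The abstract Crank-Nicolson equation\<close>

definition symmetric_op :: "('a::real_inner \<Rightarrow> 'a) \<Rightarrow> bool" where
  "symmetric_op T \<longleftrightarrow> (\<forall>x y. T x \<bullet> y = x \<bullet> T y)"

text \<open>
  \<open>\<J>\<close> plays the role of multiplication by the imaginary unit, so that the complex Hilbert space of
  the scheme can be treated as a real one.
\<close>

locale crank_nicolson =
  fixes S D W \<J> :: "'a::{real_inner,complete_space} \<Rightarrow> 'a" and c hbar :: real
  assumes bounded: "bounded_linear S" "bounded_linear D" "bounded_linear W" "bounded_linear \<J>"
    and symmetric: "symmetric_op S" "symmetric_op D" "symmetric_op W"
    and S_coercive: "\<And>x. 1 / 3 * (norm x)\<^sup>2 \<le> S x \<bullet> x"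
    and S_D_commute: "\<And>x. S (D x) = D (S x)"
    and \<J>_skew: "\<And>x y. \<J> x \<bullet> y = - (x \<bullet> \<J> y)"
    and \<J>_\<J>: "\<And>x. \<J> (\<J> x) = - x"
    and \<J>_commute: "\<And>x. \<J> (S x) = S (\<J> x)" "\<And>x. \<J> (D x) = D (\<J> x)" "\<And>x. \<J> (W x) = W (\<J> x)"
    and hbar_pos: "0 < hbar"
begin

sublocale S: bounded_linear S by (rule bounded)
sublocale \<J>: bounded_linear \<J> by (rule bounded)

definition R :: "'a \<Rightarrow> 'a" where
  "R = inv S"

lemma S_bij: "bij S"
  by (rule coercive_bij[OF bounded(1) _ S_coercive]) simp

lemma S_R [simp]: "S (R x) = x"
  and R_S [simp]: "R (S x) = x"
  using S_bij by (simp_all add: R_def bij_def surj_f_inv_f)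

text \<open>The factor is the reciprocal of the coercivity constant of \<open>S\<close>; it becomes
  the 3 in the estimate of one time step.\<close>

lemma norm_R_le: "norm (R x) \<le> 3 * norm x"
  using coercive_norm_ge[of "1/3" S "R x", OF S_coercive] by simp

lemma bounded_linear_R: "bounded_linear R"
proof (rule bounded_linear_intro[where K = 3])
  show "R (x + y) = R x + R y" for x y
    by (metis R_S S_R S.add)
  show "R (r *\<^sub>R x) = r *\<^sub>R R x" for r x
    by (metis R_S S_R S.scaleR)
qed (use norm_R_le in \<open>simp add: mult.commute\<close>)

sublocale R: bounded_linear R by (rule bounded_linear_R)

lemma R_D_commute: "R (D x) = D (R x)"
  by (metis R_S S_R S_D_commute)

lemma R_symmetric: "R x \<bullet> y = x \<bullet> R y"
  by (metis S_R symmetric(1) symmetric_op_def)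

text \<open>\<open>R\<close> does not stand before \<open>W\<close>, because the scheme applies
  \<open>S\<close> to the potential term. This matters for symmetry, as \<open>W\<close> need not
  commute with \<open>S\<close>.\<close>

definition L :: "'a \<Rightarrow> 'a" where
  "L x = W x - c *\<^sub>R R (D x)"

lemma bounded_linear_L: "bounded_linear L"
  unfolding L_def
  by (intro bounded_linear_intros bounded bounded_linear_compose[OF R.bounded_linear_axioms])

text \<open>A product of two commuting symmetric maps is symmetric, which settles the term
  \<open>R (D x)\<close>.\<close>

lemma L_symmetric: "L x \<bullet> y = x \<bullet> L y"
  using symmetric(2,3)
  by (simp add: L_def inner_diff_left inner_diff_right symmetric_op_def R_symmetric R_D_commute)

lemma \<J>_L: "\<J> (L x) = L (\<J> x)"
  by (simp add: L_def \<J>.diff \<J>.scaleR \<J>_commute(3)) (metis R_S S_R \<J>_commute(1,2))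

text \<open>Real form of the fact that a self-adjoint operator has a real quadratic form: skewness
  of \<open>\<J>\<close> turns the pairing into its own negative once \<open>\<J>\<close> is moved
  past the symmetric \<open>L\<close>. Both solvability and the energy estimate rest on
  this.\<close>

lemma inner_\<J>_L: "\<J> (L x) \<bullet> x = 0"
  using \<J>_skew[of "L x" x] L_symmetric[of x "\<J> x"] \<J>_L[of x] by (simp add: inner_commute)

lemma norm_\<J>: "norm (\<J> x) = norm x"
  by (simp add: norm_eq_sqrt_inner \<J>_skew \<J>_\<J>)

text \<open>Kept in the form of the difference equation, before \<open>R\<close> is applied, so that
  it can be matched with the scheme node by node.\<close>

definition step :: "real \<Rightarrow> 'a \<Rightarrow> 'a \<Rightarrow> 'a \<Rightarrow> bool" where
  "step dt f A B \<longleftrightarrow>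
     hbar *\<^sub>R \<J> (S ((1 / dt) *\<^sub>R (B - A))) =
     - (c *\<^sub>R D ((1 / 2) *\<^sub>R (B + A))) + S (W ((1 / 2) *\<^sub>R (B + A))) + f"

text \<open>\<open>S\<close> can be cancelled because it is injective, and \<open>\<J>\<close>
  squares to \<open>-1\<close>, so one more application of \<open>\<J>\<close> isolates the
  increment.\<close>

lemma step_iff:
  assumes "0 < dt"
  shows "step dt f A B \<longleftrightarrow> B - A = - (dt / hbar) *\<^sub>R \<J> (L ((1 / 2) *\<^sub>R (B + A)) + R f)"
proof -
  define G where "G = L ((1 / 2) *\<^sub>R (B + A)) + R f"
  have "hbar *\<^sub>R \<J> (S ((1 / dt) *\<^sub>R (B - A))) = S ((hbar / dt) *\<^sub>R \<J> (B - A))"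
    by (simp only: S.scaleR \<J>.scaleR \<J>_commute(1) scaleR_scaleR) simp
  moreover have "S G = - (c *\<^sub>R D ((1 / 2) *\<^sub>R (B + A))) + S (W ((1 / 2) *\<^sub>R (B + A))) + f"
    by (simp only: G_def L_def S.add S.diff S.scaleR S_R) simp
  ultimately have "step dt f A B \<longleftrightarrow> S ((hbar / dt) *\<^sub>R \<J> (B - A)) = S G"
    by (simp only: step_def)
  also have "\<dots> \<longleftrightarrow> (hbar / dt) *\<^sub>R \<J> (B - A) = G"
    by (metis R_S)
  also have "\<dots> \<longleftrightarrow> \<J> (B - A) = (dt / hbar) *\<^sub>R G"
    using assms hbar_pos by (auto simp: field_simps)
  also have "\<dots> \<longleftrightarrow> \<J> (\<J> (B - A)) = \<J> ((dt / hbar) *\<^sub>R G)"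
    by (metis \<J>_\<J> minus_equation_iff)
  also have "\<dots> \<longleftrightarrow> B - A = - (dt / hbar) *\<^sub>R \<J> G"
    unfolding \<J>_\<J> \<J>.scaleR scaleR_minus_left by (metis minus_minus)
  finally show ?thesis
    by (simp add: G_def)
qed

text \<open>In terms of the midpoint \<open>C\<close> of \<open>A\<close> and \<open>B\<close> the
  equation reads \<open>T C = G\<close>. The part of \<open>T\<close> containing \<open>\<J>\<close>
  contributes nothing to \<open>T x \<bullet> x\<close>, so \<open>T\<close> is coercive with
  constant 1 for every step size.\<close>

lemma ex1_step:
  assumes "0 < dt"
  shows "\<exists>!B. step dt f A B"
proof -
  define T where "T = (\<lambda>x. x + (dt / (2 * hbar)) *\<^sub>R \<J> (L x))"
  have "bounded_linear T"
    unfolding T_def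
    by (intro bounded_linear_intros bounded_linear_L bounded_linear_compose[OF bounded(4)])
  moreover have "1 * (norm x)\<^sup>2 \<le> T x \<bullet> x" for x
    by (simp add: T_def inner_add_left inner_\<J>_L power2_norm_eq_inner)
  ultimately have bij: "bij T"
    using coercive_bij[of T 1] by simp
  define G where "G = A - (dt / (2 * hbar)) *\<^sub>R \<J> (R f)"
  have *: "step dt f A B \<longleftrightarrow> T ((1 / 2) *\<^sub>R (B + A)) = G" for B
  proof -
    define C where "C = (1 / 2) *\<^sub>R (B + A)"
    have B: "B = 2 *\<^sub>R C - A"
      by (simp add: C_def)
    have "step dt f A B \<longleftrightarrow> B - A = - (dt / hbar) *\<^sub>R \<J> (L C + R f)"
      unfolding C_def by (rule step_iff[OF assms])
    also have "\<dots> \<longleftrightarrow> (1 / 2) *\<^sub>R (B - A) = (1 / 2) *\<^sub>R (- (dt / hbar) *\<^sub>R \<J> (L C + R f))"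
      by (subst scaleR_cancel_left) simp
    also have "B - A = 2 *\<^sub>R (C - A)"
      by (simp add: B scaleR_2)
    also have "(1 / 2) *\<^sub>R 2 *\<^sub>R (C - A) = C - A"
      by simp
    also have "(1 / 2) *\<^sub>R (- (dt / hbar) *\<^sub>R \<J> (L C + R f)) = G - A - (T C - C)"
      by (simp add: G_def T_def \<J>.add algebra_simps)
    finally show ?thesis
      unfolding C_def[symmetric] by (auto simp: algebra_simps)
  qed
  show ?thesis
  proof
    show "step dt f A (2 *\<^sub>R inv T G - A)"
      using bij by (simp add: * bij_def surj_f_inv_f)
  next
    fix B assume "step dt f A B"
    then have "(1 / 2) *\<^sub>R (B + A) = inv T G"
      using bij by (metis * bij_inv_eq_iff)
    then show "B = 2 *\<^sub>R inv T G - A"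
      by (metis add_diff_cancel_right' divide_self scaleR_one scaleR_scaleR times_divide_eq_right
          mult.right_neutral zero_neq_numeral)
  qed
qed

text \<open>The two-sided form serves twice: its upper half gives stability, and both halves
  together give conservation when \<open>f = 0\<close>.\<close>

lemma norm_step:
  assumes "0 < dt" and "step dt f A B"
  shows "\<bar>norm B - norm A\<bar> \<le> 3 * dt / hbar * norm f"
proof -
  define C where "C = (1 / 2) *\<^sub>R (B + A)"
  have BA: "B - A = - (dt / hbar) *\<^sub>R \<J> (L C + R f)"
    using assms by (simp add: C_def step_iff)
  \<comment> \<open>A difference of squares: the cross terms cancel by symmetry of the inner
    product.\<close>
  have "(norm B - norm A) * (norm B + norm A) = (B - A) \<bullet> (B + A)"
    by (simp add: power2_norm_eq_inner[symmetric] inner_diff_left inner_add_right inner_commute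
        dot_square_norm power2_eq_square algebra_simps)
  also have "\<dots> = 2 * ((B - A) \<bullet> C)"
    by (simp add: C_def)
  \<comment> \<open>Only the source term survives, because \<open>\<J> (L C)\<close> is orthogonal
    to \<open>C\<close>.\<close>
  also have "\<dots> = - (2 * dt / hbar) * (\<J> (R f) \<bullet> C)"
    by (simp add: BA \<J>.add inner_add_left inner_\<J>_L)
  finally have "\<bar>(norm B - norm A) * (norm B + norm A)\<bar> = \<bar>- (2 * dt / hbar) * (\<J> (R f) \<bullet> C)\<bar>"
    by (rule arg_cong)
  then have "\<bar>norm B - norm A\<bar> * (norm B + norm A) = 2 * dt / hbar * \<bar>\<J> (R f) \<bullet> C\<bar>"
    using assms hbar_pos by (simp add: abs_mult)
  also have "\<dots> \<le> 2 * dt / hbar * (norm (\<J> (R f)) * norm C)"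
    using assms hbar_pos by (intro mult_left_mono Cauchy_Schwarz_ineq2) auto
  \<comment> \<open>The triangle inequality for the midpoint produces the factor
    \<open>norm B + norm A\<close> already present on the left; it is cancelled below unless both
    norms vanish.\<close>
  also have "\<dots> \<le> 2 * dt / hbar * ((3 * norm f) * ((norm B + norm A) / 2))"
    using assms hbar_pos norm_R_le[of f] norm_triangle_ineq[of B A]
    by (intro mult_left_mono mult_mono) (auto simp: norm_\<J> C_def)
  also have "\<dots> = (3 * dt / hbar * norm f) * (norm B + norm A)"
    by simp
  finally have *: "\<bar>norm B - norm A\<bar> * (norm B + norm A) \<le> (3 * dt / hbar * norm f) * (norm B + norm A)" .
  show ?thesis
  proof (cases "norm B + norm A = 0")
    case True
    then have "B = 0" "A = 0"
      using norm_ge_zero[of A] norm_ge_zero[of B] by (simp_all add: add_nonneg_eq_0_iff)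
    then show ?thesis
      using assms hbar_pos by simp
  next
    case False
    then have "0 < norm B + norm A"
      using norm_ge_zero[of A] norm_ge_zero[of B] by linarith
    with * show ?thesis
      by (rule mult_right_le_imp_le)
  qed
qed

end

section \<open>Difference operators with zero boundary values\<close>

lemma coord_Abs_ell2:
  "(\<lambda>p. (cmod (f p))\<^sup>2) summable_on UNIV \<Longrightarrow> coord (Abs_ell2 f) = f"
  by (simp add: Abs_ell2_inverse)

lemma ell2_bounded_linearI:
  assumes "\<And>f g p. coord (T (f + g)) p = coord (T f) p + coord (T g) p"
    and "\<And>r f p. coord (T (r *\<^sub>R f)) p = complex_of_real r * coord (T f) p"
    and "\<And>f. norm (T f) \<le> B * norm f"
  shows "bounded_linear T"
  by (rule bounded_linear_intro[where K = B])
    (auto intro!: ell2_eqI simp: assms mult.commute)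

text \<open>For unbounded \<open>w\<close> the product may fail to be square summable, and then
  \<open>Abs_ell2\<close> has no specified value; the context below therefore fixes a bound.\<close>

definition mult_op :: "('a \<Rightarrow> complex) \<Rightarrow> 'a ell2 \<Rightarrow> 'a ell2" where
  "mult_op w f = Abs_ell2 (\<lambda>p. w p * coord f p)"

context
  fixes w :: "'a \<Rightarrow> complex" and B :: real
  assumes w: "\<And>p. cmod (w p) \<le> B"
begin

lemma cmod_mult_square_le: "(cmod (w p * z))\<^sup>2 \<le> B\<^sup>2 * (cmod z)\<^sup>2"
proof -
  have "cmod (w p) * cmod z \<le> B * cmod z"
    by (rule mult_right_mono[OF w]) simp
  then show ?thesis
    unfolding norm_mult power_mult_distrib[symmetric] by (rule power_mono) simp
qed

lemma coord_mult_op: "coord (mult_op w f) p = w p * coord f p"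
proof -
  have "(\<lambda>p. (cmod (w p * coord f p))\<^sup>2) summable_on UNIV"
    by (rule summable_on_comparison_test[OF summable_on_cmult_right[OF summable_coord[of f]]])
      (use cmod_mult_square_le in auto)
  then show ?thesis
    by (simp add: mult_op_def coord_Abs_ell2)
qed

lemma norm_mult_op_le: "norm (mult_op w f) \<le> B * norm f"
proof (rule power2_le_imp_le)
  have "(norm (mult_op w f))\<^sup>2 \<le> (\<Sum>\<^sub>\<infinity>p. B\<^sup>2 * (cmod (coord f p))\<^sup>2)"
    unfolding norm_ell2_square
    by (rule infsum_mono[OF summable_coord summable_on_cmult_right[OF summable_coord]])
      (use cmod_mult_square_le in \<open>simp add: coord_mult_op\<close>)
  also have "\<dots> = (B * norm f)\<^sup>2"
    by (simp add: infsum_cmult_right' norm_ell2_square power_mult_distrib)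
  finally show "(norm (mult_op w f))\<^sup>2 \<le> (B * norm f)\<^sup>2" .
  show "0 \<le> B * norm f"
    using order_trans[OF norm_ge_zero w] by simp
qed

lemma bounded_linear_mult_op: "bounded_linear (mult_op w)"
  by (rule ell2_bounded_linearI[OF _ _ norm_mult_op_le]) (simp_all add: coord_mult_op algebra_simps)

lemma mult_op_adjoint: "mult_op w f \<bullet> g = f \<bullet> mult_op (\<lambda>p. cnj (w p)) g"
proof -
  have "coord (mult_op (\<lambda>p. cnj (w p)) g) p = cnj (w p) * coord g p" for p
  proof -
    \<comment> \<open>Conjugating the multiplier leaves all moduli unchanged, so summability is
      inherited from \<open>mult_op w g\<close>.\<close>
    have "(\<lambda>p. (cmod (cnj (w p) * coord g p))\<^sup>2) summable_on UNIV"
      using summable_coord[of "mult_op w g" UNIV] by (simp add: coord_mult_op norm_mult)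
    then show ?thesis
      by (simp add: mult_op_def coord_Abs_ell2)
  qed
  then show ?thesis
    by (simp add: inner_ell2_def coord_mult_op inner_complex_def algebra_simps)
qed

end

text \<open>
  The operator \<open>f \<mapsto> f \<circ> \<sigma>\<close> compressed to the families supported on \<open>I\<close>: the values of \<open>f\<close> outside
  \<open>I\<close> are replaced by zero, as with homogeneous boundary values.
\<close>

definition shift_op :: "'a set \<Rightarrow> ('a \<Rightarrow> 'a) \<Rightarrow> 'a ell2 \<Rightarrow> 'a ell2" where
  "shift_op I \<sigma> f = Abs_ell2 (\<lambda>p. if p \<in> I \<and> \<sigma> p \<in> I then coord f (\<sigma> p) else 0)"

context
  fixes I :: "'a set" and \<sigma> \<tau> :: "'a \<Rightarrow> 'a"
  assumes \<tau>\<sigma>: "\<And>p. p \<in> I \<Longrightarrow> \<sigma> p \<in> I \<Longrightarrow> \<tau> (\<sigma> p) = p"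
begin

text \<open>The predecessor on naturals sends both 0 and 1 to 0. Injectivity is therefore claimed
  only where a node and its image both lie in \<open>I\<close>.\<close>

lemma inj_on_shift: "inj_on \<sigma> {p \<in> I. \<sigma> p \<in> I}"
  by (rule inj_on_inverseI[where g = \<tau>]) (simp add: \<tau>\<sigma>)

lemma coord_shift_op:
  "coord (shift_op I \<sigma> f) p = (if p \<in> I \<and> \<sigma> p \<in> I then coord f (\<sigma> p) else 0)"
proof -
  have "((\<lambda>p. (cmod (coord f p))\<^sup>2) \<circ> \<sigma>) summable_on {p \<in> I. \<sigma> p \<in> I}"
    by (subst summable_on_reindex[OF inj_on_shift, symmetric]) (rule summable_coord)
  then have "(\<lambda>p. (cmod (if p \<in> I \<and> \<sigma> p \<in> I then coord f (\<sigma> p) else 0))\<^sup>2) summable_on UNIV"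
    by (subst summable_on_cong_neutral[where T = "{p \<in> I. \<sigma> p \<in> I}"
          and g = "(\<lambda>p. (cmod (coord f p))\<^sup>2) \<circ> \<sigma>"]) auto
  then show ?thesis
    by (simp add: shift_op_def coord_Abs_ell2)
qed

lemma norm_shift_op_le: "norm (shift_op I \<sigma> f) \<le> norm f"
proof (rule power2_le_imp_le)
  have "(norm (shift_op I \<sigma> f))\<^sup>2 = infsum ((\<lambda>p. (cmod (coord f p))\<^sup>2) \<circ> \<sigma>) {p \<in> I. \<sigma> p \<in> I}"
    unfolding norm_ell2_square by (rule infsum_cong_neutral) (auto simp: coord_shift_op)
  also have "\<dots> = (\<Sum>\<^sub>\<infinity>p\<in>\<sigma> ` {p \<in> I. \<sigma> p \<in> I}. (cmod (coord f p))\<^sup>2)"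
    by (rule infsum_reindex[OF inj_on_shift, symmetric])
  also have "\<dots> \<le> (norm f)\<^sup>2"
    unfolding norm_ell2_square by (rule infsum_mono2[OF summable_coord summable_coord]) auto
  finally show "(norm (shift_op I \<sigma> f))\<^sup>2 \<le> (norm f)\<^sup>2" .
qed simp

lemma bounded_linear_shift_op: "bounded_linear (shift_op I \<sigma>)"
  by (rule ell2_bounded_linearI[where B = 1]) (simp_all add: coord_shift_op norm_shift_op_le)

end

text \<open>The sum is reindexed along \<open>\<sigma>\<close>, which maps the nodes with
  \<open>\<sigma>\<close>-image in \<open>I\<close> bijectively onto those with
  \<open>\<tau>\<close>-image in \<open>I\<close>.\<close>

lemma shift_op_adjoint:
  assumes \<tau>\<sigma>: "\<And>p. p \<in> I \<Longrightarrow> \<sigma> p \<in> I \<Longrightarrow> \<tau> (\<sigma> p) = p"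
    and \<sigma>\<tau>: "\<And>p. p \<in> I \<Longrightarrow> \<tau> p \<in> I \<Longrightarrow> \<sigma> (\<tau> p) = p"
  shows "shift_op I \<sigma> f \<bullet> g = f \<bullet> shift_op I \<tau> g"
proof -
  let ?A = "{p \<in> I. \<sigma> p \<in> I}" and ?B = "{p \<in> I. \<tau> p \<in> I}"
  have bij: "bij_betw \<sigma> ?A ?B"
    by (rule bij_betw_byWitness[where f' = \<tau>]) (auto simp: \<tau>\<sigma> \<sigma>\<tau>)
  have "shift_op I \<sigma> f \<bullet> g = (\<Sum>\<^sub>\<infinity>p\<in>?A. coord f (\<sigma> p) \<bullet> coord g (\<tau> (\<sigma> p)))"
    unfolding inner_ell2_def by (rule infsum_cong_neutral) (auto simp: coord_shift_op[of I \<sigma> \<tau>, OF \<tau>\<sigma>] \<tau>\<sigma>)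
  also have "\<dots> = (\<Sum>\<^sub>\<infinity>p\<in>?B. coord f p \<bullet> coord g (\<tau> p))"
    by (rule infsum_reindex_bij_betw[OF bij])
  also have "\<dots> = f \<bullet> shift_op I \<tau> g"
    unfolding inner_ell2_def by (rule infsum_cong_neutral) (auto simp: coord_shift_op[of I \<tau> \<sigma>, OF \<sigma>\<tau>])
  finally show ?thesis .
qed

section \<open>Second differences built from shifts\<close>

definition proj_op :: "'a set \<Rightarrow> 'a ell2 \<Rightarrow> 'a ell2" where
  "proj_op I = shift_op I (\<lambda>p. p)"

text \<open>The central term uses \<open>proj_op\<close> instead of the identity, so that the result
  vanishes off \<open>I\<close>.\<close>

definition diff2_op :: "'a set \<Rightarrow> ('a \<Rightarrow> 'a) \<Rightarrow> ('a \<Rightarrow> 'a) \<Rightarrow> real \<Rightarrow> 'a ell2 \<Rightarrow> 'a ell2" where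
  "diff2_op I \<sigma> \<tau> h f = (1 / h\<^sup>2) *\<^sub>R (shift_op I \<sigma> f - 2 *\<^sub>R proj_op I f + shift_op I \<tau> f)"

context
  fixes I :: "'a set" and \<sigma> \<tau> :: "'a \<Rightarrow> 'a" and h :: real
  assumes inverse: "\<And>p. p \<in> I \<Longrightarrow> \<sigma> p \<in> I \<Longrightarrow> \<tau> (\<sigma> p) = p"
    "\<And>p. p \<in> I \<Longrightarrow> \<tau> p \<in> I \<Longrightarrow> \<sigma> (\<tau> p) = p"
begin

lemma coord_diff2_op:
  "coord (diff2_op I \<sigma> \<tau> h f) p =
     (if p \<in> I then ((if \<sigma> p \<in> I then coord f (\<sigma> p) else 0) - 2 * coord f p
        + (if \<tau> p \<in> I then coord f (\<tau> p) else 0)) / complex_of_real (h\<^sup>2) else 0)"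
  by (simp add: diff2_op_def proj_op_def coord_shift_op[of I \<sigma> \<tau>, OF inverse(1)] coord_shift_op[of I \<tau> \<sigma>, OF inverse(2)]
      coord_shift_op[of I "\<lambda>p. p" "\<lambda>p. p"])

lemma bounded_linear_diff2_op: "bounded_linear (diff2_op I \<sigma> \<tau> h)"
  unfolding diff2_op_def proj_op_def
  by (intro bounded_linear_intros bounded_linear_shift_op[of I \<sigma> \<tau>, OF inverse(1)]
      bounded_linear_shift_op[of I \<tau> \<sigma>, OF inverse(2)] bounded_linear_shift_op[of I "\<lambda>p. p" "\<lambda>p. p"]) simp_all

lemma symmetric_diff2_op: "symmetric_op (diff2_op I \<sigma> \<tau> h)"
  by (simp add: symmetric_op_def diff2_op_def proj_op_def inner_add_left inner_add_right
      inner_diff_left inner_diff_right shift_op_adjoint[of I \<sigma> \<tau>, OF inverse] shift_op_adjoint[of I \<tau> \<sigma>, OF inverse(2,1)]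
      shift_op_adjoint[of I "\<lambda>p. p" "\<lambda>p. p"] algebra_simps)

text \<open>Two shifts and twice a projection, each of norm at most 1, add up to 4.\<close>

lemma norm_diff2_op_le: "norm (diff2_op I \<sigma> \<tau> h f) \<le> 4 / h\<^sup>2 * norm f"
proof -
  have "norm (shift_op I \<sigma> f - 2 *\<^sub>R proj_op I f + shift_op I \<tau> f)
      \<le> norm (shift_op I \<sigma> f) + norm (2 *\<^sub>R proj_op I f) + norm (shift_op I \<tau> f)"
    by (meson add_right_mono norm_triangle_ineq norm_triangle_ineq4 order_trans)
  also have "\<dots> \<le> 4 * norm f"
    using norm_shift_op_le[of I \<sigma> \<tau> f, OF inverse(1)] norm_shift_op_le[of I \<tau> \<sigma> f, OF inverse(2)]
      norm_shift_op_le[of I "\<lambda>p. p" "\<lambda>p. p" f]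
    by (simp add: proj_op_def)
  finally have "1 / h\<^sup>2 * norm (shift_op I \<sigma> f - 2 *\<^sub>R proj_op I f + shift_op I \<tau> f) \<le> 1 / h\<^sup>2 * (4 * norm f)"
    by (rule mult_left_mono) simp
  then show ?thesis
    by (simp add: diff2_op_def)
qed

text \<open>Cauchy-Schwarz with the preceding norm bound: the Numerov weight
  \<open>h\<^sup>2 / 12\<close> times \<open>4 / h\<^sup>2\<close> is \<open>1 / 3\<close>.\<close>

lemma diff2_op_coercive:
  assumes "h \<noteq> 0"
  shows "- 1 / 3 * (norm f)\<^sup>2 \<le> (h\<^sup>2 / 12) * (diff2_op I \<sigma> \<tau> h f \<bullet> f)"
proof -
  have "- (diff2_op I \<sigma> \<tau> h f \<bullet> f) \<le> norm (diff2_op I \<sigma> \<tau> h f) * norm f"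
    using norm_cauchy_schwarz[of "- diff2_op I \<sigma> \<tau> h f" f] by simp
  also have "\<dots> \<le> 4 / h\<^sup>2 * norm f * norm f"
    by (intro mult_right_mono norm_diff2_op_le) simp
  finally have "(h\<^sup>2 / 12) * - (diff2_op I \<sigma> \<tau> h f \<bullet> f) \<le> (h\<^sup>2 / 12) * (4 / h\<^sup>2 * norm f * norm f)"
    by (rule mult_left_mono) simp
  also have "\<dots> = 1 / 3 * (norm f)\<^sup>2"
    using assms by (simp add: power2_eq_square)
  finally show ?thesis by simp
qed

end

section \<open>Mesh functions as elements of \<open>\<ell>\<^sup>2\<close>\<close>

text \<open>Discarding the values off the interior makes the image independent of the representative
  modulo \<open>mesh_eq\<close>.\<close>

definition ell2_of_mesh :: "nat \<Rightarrow> mesh_fun \<Rightarrow> (nat \<times> nat) ell2" where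
  "ell2_of_mesh K W = Abs_ell2 (\<lambda>(j, k). if (j, k) \<in> mesh_interior K then W j k else 0)"

definition mesh_of_ell2 :: "nat \<Rightarrow> (nat \<times> nat) ell2 \<Rightarrow> mesh_fun" where
  "mesh_of_ell2 K f = (\<lambda>j k. if (j, k) \<in> mesh_interior K then coord f (j, k) else 0)"

lemma mesh_interior_Times: "mesh_interior K = {1..} \<times> {1..K - 1}"
  by (auto simp: mesh_interior_def)

lemma zero_on_boundaryD:
  "zero_on_boundary K W \<Longrightarrow> (j, k) \<notin> mesh_interior K \<Longrightarrow> k \<le> K \<Longrightarrow> W j k = 0"
  by (auto simp: zero_on_boundary_def mesh_boundary_def mesh_def)

lemma H_h_boundary: "W \<in> H_h K \<Longrightarrow> zero_on_boundary K W"
  by (simp add: H_h_def)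

text \<open>The terms are nonnegative, so the iterated sum in \<open>H_h\<close> controls the sum
  over the product index set.\<close>

lemma summable_H_h:
  assumes "W \<in> H_h K"
  shows "(\<lambda>p. (cmod (case p of (j, k) \<Rightarrow> if (j, k) \<in> mesh_interior K then W j k else 0))\<^sup>2)
    summable_on UNIV"
proof -
  have "(\<lambda>p. (cmod (W (fst p) (snd p)))\<^sup>2) summable_on Sigma {1..} (\<lambda>_. {1..K - 1})"
    by (rule summable_on_SigmaI[where g = "\<lambda>j. \<Sum>k = 1..K - 1. (cmod (W j k))\<^sup>2"])
      (use assms in \<open>auto simp: H_h_def intro: has_sum_finiteI\<close>)
  then show ?thesis
    by (subst summable_on_cong_neutral[where T = "{1..} \<times> {1..K - 1}"
          and g = "\<lambda>p. (cmod (W (fst p) (snd p)))\<^sup>2"])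
      (auto simp: mesh_interior_def split: if_splits)
qed

lemma coord_ell2_of_mesh:
  assumes "W \<in> H_h K"
  shows "coord (ell2_of_mesh K W) (j, k) = (if (j, k) \<in> mesh_interior K then W j k else 0)"
  using coord_Abs_ell2[OF summable_H_h[OF assms]] by (simp add: ell2_of_mesh_def)

lemma mesh_of_ell2_in_H_h: "mesh_of_ell2 K f \<in> H_h K"
proof -
  have "(\<lambda>j. infsum (\<lambda>k. (cmod (coord f (j, k)))\<^sup>2) {1..K - 1}) summable_on {1..}"
    by (rule summable_on_Sigma_banach)
      (use summable_coord[of f "{1..} \<times> {1..K - 1}"] in \<open>simp add: case_prod_unfold\<close>)
  then have "(\<lambda>j. \<Sum>k = 1..K - 1. (cmod (mesh_of_ell2 K f j k))\<^sup>2) summable_on {1..}"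
    by (rule summable_on_cong[THEN iffD1, rotated])
      (auto intro!: sum.cong simp: mesh_of_ell2_def mesh_interior_Times)
  then show ?thesis
    by (auto simp: H_h_def zero_on_boundary_def mesh_boundary_def mesh_of_ell2_def)
qed

text \<open>The \<open>ell2\<close> norm carries no mesh weight. The difference is one common
  factor, so norm estimates transfer without loss.\<close>

lemma H_norm_eq_norm:
  assumes W: "W \<in> H_h K" and "0 \<le> hx" "0 \<le> hy"
  shows "H_norm hx hy K W = sqrt (hx * hy) * norm (ell2_of_mesh K W)"
proof -
  \<comment> \<open>The inner sums are real, so the infinite sum can be taken over the
    reals.\<close>
  have "(\<Sum>k = 1..K - 1. W j k * cnj (W j k) * complex_of_real hx * complex_of_real hy)
      = complex_of_real (hx * hy * (\<Sum>k = 1..K - 1. (cmod (W j k))\<^sup>2))" for j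
    by (simp add: sum_distrib_left complex_norm_square[symmetric] mult_ac)
  moreover have "(\<lambda>j. hx * hy * (\<Sum>k = 1..K - 1. (cmod (W j k))\<^sup>2)) summable_on {1..}"
    using W by (intro summable_on_cmult_right) (simp add: H_h_def)
  ultimately have "H_inner hx hy K W W
      = complex_of_real (\<Sum>\<^sub>\<infinity>j\<in>{1..}. hx * hy * (\<Sum>k = 1..K - 1. (cmod (W j k))\<^sup>2))"
    unfolding H_inner_def by (simp only: infsumI[OF has_sum_of_real[OF has_sum_infsum]])
  then have "Re (H_inner hx hy K W W) = hx * hy * (\<Sum>\<^sub>\<infinity>j\<in>{1..}. \<Sum>k = 1..K - 1. (cmod (W j k))\<^sup>2)"
    by (simp add: infsum_cmult_right')
  also have "(\<Sum>\<^sub>\<infinity>j\<in>{1..}. \<Sum>k = 1..K - 1. (cmod (W j k))\<^sup>2)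
      = (\<Sum>\<^sub>\<infinity>j\<in>{1..}. \<Sum>\<^sub>\<infinity>k\<in>{1..K - 1}. (cmod (coord (ell2_of_mesh K W) (j, k)))\<^sup>2)"
    by (rule infsum_cong)
      (auto intro!: sum.cong simp: coord_ell2_of_mesh[OF W] mesh_interior_Times)
  also have "\<dots> = (\<Sum>\<^sub>\<infinity>p\<in>{1..} \<times> {1..K - 1}. (cmod (coord (ell2_of_mesh K W) p))\<^sup>2)"
    by (rule infsum_Sigma_banach) (rule summable_coord)
  also have "\<dots> = (norm (ell2_of_mesh K W))\<^sup>2"
    unfolding norm_ell2_square
    by (rule infsum_cong_neutral)
      (auto simp: coord_ell2_of_mesh[OF W] mesh_interior_Times split: if_splits)
  finally show ?thesis
    by (simp add: H_norm_def real_sqrt_mult)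
qed

lemma H_h_lincomb:
  assumes "U \<in> H_h K" "W \<in> H_h K"
  shows "(\<lambda>j k. a * U j k + b * W j k) \<in> H_h K"
proof -
  have "(\<lambda>j. \<Sum>k = 1..K - 1. (cmod (a * U j k + b * W j k))\<^sup>2) summable_on {1..}"
  proof (rule summable_on_comparison_test)
    show "(\<lambda>j. 2 * (cmod a)\<^sup>2 * (\<Sum>k = 1..K - 1. (cmod (U j k))\<^sup>2)
        + 2 * (cmod b)\<^sup>2 * (\<Sum>k = 1..K - 1. (cmod (W j k))\<^sup>2)) summable_on {1..}"
      using assms by (intro summable_on_add summable_on_cmult_right) (auto simp: H_h_def)
    show "(\<Sum>k = 1..K - 1. (cmod (a * U j k + b * W j k))\<^sup>2)
        \<le> 2 * (cmod a)\<^sup>2 * (\<Sum>k = 1..K - 1. (cmod (U j k))\<^sup>2)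
        + 2 * (cmod b)\<^sup>2 * (\<Sum>k = 1..K - 1. (cmod (W j k))\<^sup>2)" for j
      unfolding sum_distrib_left sum.distrib[symmetric]
      using cmod_add_square_le[of "a * U j k" "b * W j k" for k]
      by (intro sum_mono) (simp add: norm_mult power_mult_distrib mult_ac)
  qed (auto intro: sum_nonneg)
  moreover have "zero_on_boundary K (\<lambda>j k. a * U j k + b * W j k)"
    using assms[THEN H_h_boundary] by (fastforce simp: zero_on_boundary_def)
  ultimately show ?thesis
    by (simp add: H_h_def)
qed

lemma mesh_of_ell2_of_mesh:
  assumes "U \<in> H_h K" "k \<le> K"
  shows "mesh_of_ell2 K (ell2_of_mesh K U) j k = U j k"
  using assms zero_on_boundaryD[OF H_h_boundary[OF assms(1)], of j k]
  by (simp add: mesh_of_ell2_def coord_ell2_of_mesh)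

lemma H_h_cong:
  assumes "mesh_eq K U W" "U \<in> H_h K"
  shows "W \<in> H_h K"
proof -
  have eq: "W j k = U j k" if "k \<le> K" for j k
    using assms(1) that by (auto simp: mesh_eq_def mesh_def)
  have "zero_on_boundary K W"
    using zero_on_boundaryD[OF H_h_boundary[OF assms(2)]] eq
    by (auto simp: zero_on_boundary_def mesh_boundary_def mesh_def)
  moreover have "(\<lambda>j. \<Sum>k = 1..K - 1. (cmod (W j k))\<^sup>2) = (\<lambda>j. \<Sum>k = 1..K - 1. (cmod (U j k))\<^sup>2)"
    by (intro ext sum.cong) (auto simp: eq)
  ultimately show ?thesis
    using assms(2) by (simp add: H_h_def)
qed

lemma ell2_of_mesh_cong:
  assumes "mesh_eq K U W"
  shows "ell2_of_mesh K U = ell2_of_mesh K W"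
  unfolding ell2_of_mesh_def
  by (rule arg_cong[where f = Abs_ell2]) (use assms in \<open>auto simp: mesh_eq_def mesh_def mesh_interior_def\<close>)

section \<open>The kinetic step\<close>

text \<open>Boundedness of \<open>Vt\<close> is asked for at the mesh abscissas only, which is what
  makes multiplication by it a bounded operator; \<open>mesh_values_bounded\<close> supplies the
  bound in the end.\<close>

locale numerov_mesh =
  fixes hbar m0 hx hy Vmax :: real and K :: nat and Vt :: "real \<Rightarrow> real"
  assumes hbar: "0 < hbar" and hx: "0 < hx" and hy: "0 < hy"
    and Vt_bounded: "\<And>j. \<bar>Vt (real j * hx)\<bar> \<le> Vmax"
begin

section \<open>The Numerov operators as bounded symmetric maps\<close>

definition Dx :: "(nat \<times> nat) ell2 \<Rightarrow> (nat \<times> nat) ell2" where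
  "Dx = diff2_op (mesh_interior K) (\<lambda>(j, k). (Suc j, k)) (\<lambda>(j, k). (j - 1, k)) hx"

definition Dy :: "(nat \<times> nat) ell2 \<Rightarrow> (nat \<times> nat) ell2" where
  "Dy = diff2_op (mesh_interior K) (\<lambda>(j, k). (j, Suc k)) (\<lambda>(j, k). (j, k - 1)) hy"

lemma shift_inverse:
  "\<And>p. p \<in> mesh_interior K \<Longrightarrow> (case p of (j, k) \<Rightarrow> (Suc j, k)) \<in> mesh_interior K
    \<Longrightarrow> (case (case p of (j, k) \<Rightarrow> (Suc j, k)) of (j, k) \<Rightarrow> (j - 1, k)) = p"
  "\<And>p. p \<in> mesh_interior K \<Longrightarrow> (case p of (j, k) \<Rightarrow> (j - 1, k)) \<in> mesh_interior K
    \<Longrightarrow> (case (case p of (j, k) \<Rightarrow> (j - 1, k)) of (j, k) \<Rightarrow> (Suc j, k)) = p"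
  "\<And>p. p \<in> mesh_interior K \<Longrightarrow> (case p of (j, k) \<Rightarrow> (j, Suc k)) \<in> mesh_interior K
    \<Longrightarrow> (case (case p of (j, k) \<Rightarrow> (j, Suc k)) of (j, k) \<Rightarrow> (j, k - 1)) = p"
  "\<And>p. p \<in> mesh_interior K \<Longrightarrow> (case p of (j, k) \<Rightarrow> (j, k - 1)) \<in> mesh_interior K
    \<Longrightarrow> (case (case p of (j, k) \<Rightarrow> (j, k - 1)) of (j, k) \<Rightarrow> (j, Suc k)) = p"
  by (auto simp: mesh_interior_def)

lemma bounded_linear_Dx: "bounded_linear Dx"
  and bounded_linear_Dy: "bounded_linear Dy"
  unfolding Dx_def Dy_def
  by (rule bounded_linear_diff2_op[OF shift_inverse(1,2)] bounded_linear_diff2_op[OF shift_inverse(3,4)]; assumption)+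

sublocale Dx: bounded_linear Dx by (rule bounded_linear_Dx)
sublocale Dy: bounded_linear Dy by (rule bounded_linear_Dy)

lemma symmetric_Dx: "symmetric_op Dx"
  and symmetric_Dy: "symmetric_op Dy"
  unfolding Dx_def Dy_def
  by (rule symmetric_diff2_op[OF shift_inverse(1,2)] symmetric_diff2_op[OF shift_inverse(3,4)]; assumption)+

lemma coord_Dx:
  "coord (Dx f) (j, k) = (if (j, k) \<in> mesh_interior K then dxx hx (mesh_of_ell2 K f) j k else 0)"
  unfolding Dx_def by (subst coord_diff2_op[OF shift_inverse(1,2)]) (simp_all add: dxx_def mesh_of_ell2_def)

lemma coord_Dy:
  "coord (Dy f) (j, k) = (if (j, k) \<in> mesh_interior K then dyy hy (mesh_of_ell2 K f) j k else 0)"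
  unfolding Dy_def by (subst coord_diff2_op[OF shift_inverse(3,4)]) (simp_all add: dyy_def mesh_of_ell2_def)

text \<open>The interior is a product of index ranges in \<open>j\<close> and \<open>k\<close>, so
  cutting off in one direction commutes with differencing in the other.\<close>

lemma Dx_Dy_commute: "Dx (Dy f) = Dy (Dx f)"
proof (rule ell2_eqI)
  fix p :: "nat \<times> nat"
  obtain j k where p: "p = (j, k)" by (cases p)
  show "coord (Dx (Dy f)) p = coord (Dy (Dx f)) p"
    unfolding p
    by (simp add: coord_Dx coord_Dy mesh_of_ell2_def dxx_def dyy_def mesh_interior_def
        divide_inverse algebra_simps)
qed

text \<open>Off the interior \<open>S\<close> acts as the identity, so it is invertible on all of
  \<open>ell2\<close> and not only on families supported in the interior.\<close>

definition S :: "(nat \<times> nat) ell2 \<Rightarrow> (nat \<times> nat) ell2" where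
  "S f = f + (hx\<^sup>2 / 12) *\<^sub>R Dx f + (hy\<^sup>2 / 12) *\<^sub>R Dy f"

definition D :: "(nat \<times> nat) ell2 \<Rightarrow> (nat \<times> nat) ell2" where
  "D f = (Dx f + (hy\<^sup>2 / 12) *\<^sub>R Dy (Dx f)) + (Dy f + (hx\<^sup>2 / 12) *\<^sub>R Dx (Dy f))"

text \<open>The cut-off makes multiplication, like \<open>Dx\<close> and \<open>Dy\<close>, produce
  families supported in the interior; \<open>step_supported\<close> depends on this.\<close>

definition w :: "nat \<times> nat \<Rightarrow> complex" where
  "w = (\<lambda>(j, k). if (j, k) \<in> mesh_interior K then complex_of_real (Vt (real j * hx)) else 0)"

lemma w_apply: "w (j, k) = (if (j, k) \<in> mesh_interior K then complex_of_real (Vt (real j * hx)) else 0)"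
  by (simp add: w_def)

lemma cmod_w_le: "cmod (w p) \<le> Vmax"
  using Vt_bounded order_trans[OF abs_ge_zero Vt_bounded] by (auto simp: w_def split: prod.split)

lemma coord_w: "coord (mult_op w f) p = w p * coord f p"
  by (rule coord_mult_op[OF cmod_w_le])

definition imag_op :: "(nat \<times> nat) ell2 \<Rightarrow> (nat \<times> nat) ell2" where
  "imag_op = mult_op (\<lambda>_. \<i>)"

lemma coord_imag_op: "coord (imag_op f) p = \<i> * coord f p"
  unfolding imag_op_def by (rule coord_mult_op[of _ 1]) simp

lemma mesh_of_imag_op: "mesh_of_ell2 K (imag_op f) = (\<lambda>j k. \<i> * mesh_of_ell2 K f j k)"
  by (auto simp: mesh_of_ell2_def coord_imag_op fun_eq_iff)

lemma imag_op_Dx: "imag_op (Dx f) = Dx (imag_op f)"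
proof (rule ell2_eqI)
  fix p show "coord (imag_op (Dx f)) p = coord (Dx (imag_op f)) p"
    by (cases p) (simp add: coord_imag_op coord_Dx mesh_of_imag_op dxx_def algebra_simps)
qed

lemma imag_op_Dy: "imag_op (Dy f) = Dy (imag_op f)"
proof (rule ell2_eqI)
  fix p show "coord (imag_op (Dy f)) p = coord (Dy (imag_op f)) p"
    by (cases p) (simp add: coord_imag_op coord_Dy mesh_of_imag_op dyy_def algebra_simps)
qed

lemma bounded_linear_imag_op: "bounded_linear imag_op"
  unfolding imag_op_def by (rule bounded_linear_mult_op[of _ 1]) simp

sublocale imag_op: bounded_linear imag_op by (rule bounded_linear_imag_op)

sublocale crank_nicolson S D "mult_op w" imag_op "c_hbar hbar m0" hbar
proof (rule crank_nicolson.intro)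
  show "bounded_linear S"
    unfolding S_def by (intro bounded_linear_intros bounded_linear_Dx bounded_linear_Dy)
  show "bounded_linear D"
    unfolding D_def
    by (intro bounded_linear_intros bounded_linear_Dx bounded_linear_Dy
        bounded_linear_compose[OF bounded_linear_Dx] bounded_linear_compose[OF bounded_linear_Dy])
  show "bounded_linear (mult_op w)"
    by (rule bounded_linear_mult_op[OF cmod_w_le])
  show "bounded_linear imag_op"
    by (rule bounded_linear_imag_op)
  show "symmetric_op S"
    using symmetric_Dx symmetric_Dy by (simp add: symmetric_op_def S_def inner_add_left inner_add_right)
  show "symmetric_op D"
    using symmetric_Dx symmetric_Dy
    by (simp add: symmetric_op_def D_def inner_add_left inner_add_right Dx_Dy_commute)
  have "cnj (w p) = w p" for p
    by (simp add: w_def split: prod.split)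
  then show "symmetric_op (mult_op w)"
    using mult_op_adjoint[of w, OF cmod_w_le] by (simp add: symmetric_op_def)
  \<comment> \<open>Each direction takes away at most one third of the identity, which leaves one
    third.\<close>
  show "1 / 3 * (norm f)\<^sup>2 \<le> S f \<bullet> f" for f
  proof -
    have "- 1 / 3 * (norm f)\<^sup>2 \<le> (hx\<^sup>2 / 12) * (Dx f \<bullet> f)"
      unfolding Dx_def by (rule diff2_op_coercive[OF shift_inverse(1,2)]) (use hx in simp_all)
    moreover have "- 1 / 3 * (norm f)\<^sup>2 \<le> (hy\<^sup>2 / 12) * (Dy f \<bullet> f)"
      unfolding Dy_def by (rule diff2_op_coercive[OF shift_inverse(3,4)]) (use hy in simp_all)
    ultimately show ?thesis
      by (simp add: S_def inner_add_left power2_norm_eq_inner)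
  qed
  show "S (D f) = D (S f)" for f
    by (simp add: S_def D_def Dx.add Dy.add Dx.scaleR Dy.scaleR Dx_Dy_commute algebra_simps)
  show "imag_op f \<bullet> g = - (f \<bullet> imag_op g)" for f g
  proof -
    have "imag_op f \<bullet> g = f \<bullet> mult_op (\<lambda>_. cnj \<i>) g"
      unfolding imag_op_def by (rule mult_op_adjoint[of _ 1]) simp
    also have "mult_op (\<lambda>_. cnj \<i>) g = - imag_op g"
      by (rule ell2_eqI, subst coord_mult_op[of _ 1]) (simp_all add: coord_imag_op)
    finally show ?thesis by simp
  qed
  show "imag_op (imag_op f) = - f" for f
    by (rule ell2_eqI) (simp add: coord_imag_op flip: mult.assoc)
  show "imag_op (S f) = S (imag_op f)" for f
    by (simp add: S_def imag_op.add imag_op.scaleR imag_op_Dx imag_op_Dy)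
  show "imag_op (D f) = D (imag_op f)" for f
    by (simp add: D_def imag_op.add imag_op.scaleR imag_op_Dx imag_op_Dy)
  show "imag_op (mult_op w f) = mult_op w (imag_op f)" for f
    by (rule ell2_eqI) (simp add: coord_imag_op coord_w)
  show "0 < hbar" by (rule hbar)
qed

section \<open>Translation of the kinetic step to \<open>ell2\<close> and back\<close>

abbreviation lift :: "mesh_fun \<Rightarrow> (nat \<times> nat) ell2" where
  "lift \<equiv> ell2_of_mesh K"

text \<open>The rows \<open>k = 0\<close> and \<open>k = K\<close> are included because
  \<open>Delta_hN\<close> takes a y-difference of \<open>dxx\<close>; there the whole row of
  \<open>U\<close> vanishes, so both sides are zero. At \<open>j = 0\<close> truncated subtraction
  would give a spurious value.\<close>

lemma mesh_of_Dx:
  assumes U: "U \<in> H_h K" and "1 \<le> j" "k \<le> K"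
  shows "mesh_of_ell2 K (Dx (lift U)) j k = dxx hx U j k"
proof (cases "(j, k) \<in> mesh_interior K")
  case True
  then show ?thesis
    using assms by (simp add: mesh_of_ell2_def[of K "Dx (lift U)"] coord_Dx dxx_def mesh_of_ell2_of_mesh[OF U])
next
  case False
  then have "(j', k) \<notin> mesh_interior K" for j'
    using assms by (auto simp: mesh_interior_def)
  then have "U j' k = 0" for j'
    using zero_on_boundaryD[OF H_h_boundary[OF U]] assms by blast
  then show ?thesis
    using False by (simp add: mesh_of_ell2_def dxx_def)
qed

text \<open>Here the column \<open>j = 0\<close> is included, since an x-difference of
  \<open>dyy\<close> at \<open>j = 1\<close> reads it.\<close>

lemma mesh_of_Dy:
  assumes U: "U \<in> H_h K" and "1 \<le> k" "k < K"
  shows "mesh_of_ell2 K (Dy (lift U)) j k = dyy hy U j k"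
proof (cases "(j, k) \<in> mesh_interior K")
  case True
  then show ?thesis
    using assms by (simp add: mesh_of_ell2_def[of K "Dy (lift U)"] coord_Dy dyy_def mesh_of_ell2_of_mesh[OF U])
next
  case False
  then have "(j, k') \<notin> mesh_interior K" for k'
    using assms by (auto simp: mesh_interior_def)
  then have "U j k' = 0" if "k' \<le> K" for k'
    using zero_on_boundaryD[OF H_h_boundary[OF U]] that by blast
  then show ?thesis
    using False assms by (simp add: mesh_of_ell2_def dyy_def)
qed

lemma coord_S_lift:
  assumes U: "U \<in> H_h K" and jk: "(j, k) \<in> mesh_interior K"
  shows "coord (S (lift U)) (j, k) = s_N hx hy U j k"
  using mesh_of_Dx[OF U, of j k] mesh_of_Dy[OF U, of k j] jk
  by (simp add: S_def s_N_def mesh_of_ell2_def coord_ell2_of_mesh[OF U] mesh_interior_def)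

lemma coord_D_lift:
  assumes U: "U \<in> H_h K" and jk: "(j, k) \<in> mesh_interior K"
  shows "coord (D (lift U)) (j, k) = Delta_hN hx hy U j k"
proof -
  have bounds: "1 \<le> j" "1 \<le> k" "k < K"
    using jk by (auto simp: mesh_interior_def)
  have "coord (Dy (Dx (lift U))) (j, k) = dyy hy (dxx hx U) j k"
    using jk bounds by (simp add: coord_Dy dyy_def mesh_of_Dx[OF U])
  moreover have "coord (Dx (Dy (lift U))) (j, k) = dxx hx (dyy hy U) j k"
    using jk bounds by (simp add: coord_Dx dxx_def mesh_of_Dy[OF U])
  moreover have "coord (Dx (lift U)) (j, k) = dxx hx U j k" "coord (Dy (lift U)) (j, k) = dyy hy U j k"
    using mesh_of_Dx[OF U, of j k] mesh_of_Dy[OF U, of k j] jk bounds by (simp_all add: mesh_of_ell2_def)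
  ultimately show ?thesis
    by (simp add: D_def Delta_hN_def s_Ny_def s_Nx_def)
qed

lemma lift_lincomb:
  assumes "U \<in> H_h K" "W \<in> H_h K"
  shows "lift (\<lambda>j k. complex_of_real a * U j k + complex_of_real b * W j k) = a *\<^sub>R lift U + b *\<^sub>R lift W"
  by (rule ell2_eqI) (auto simp: coord_ell2_of_mesh assms H_h_lincomb)

lemma mult_w_lift:
  assumes U: "U \<in> H_h K"
  shows "(\<lambda>j k. complex_of_real (Vt (real j * hx)) * U j k) \<in> H_h K" (is "?W \<in> _")
    and "lift (\<lambda>j k. complex_of_real (Vt (real j * hx)) * U j k) = mult_op w (lift U)"
proof -
  have W: "mesh_eq K (mesh_of_ell2 K (mult_op w (lift U))) ?W"
    using zero_on_boundaryD[OF H_h_boundary[OF U]]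
    by (auto simp: mesh_eq_def mesh_def mesh_of_ell2_def coord_w w_apply coord_ell2_of_mesh[OF U])
  then show *: "?W \<in> H_h K"
    using mesh_of_ell2_in_H_h by (rule H_h_cong)
  show "lift ?W = mult_op w (lift U)"
    by (rule ell2_eqI) (auto simp: coord_ell2_of_mesh[OF *] coord_ell2_of_mesh[OF U] coord_w w_apply)
qed

text \<open>Coordinates are compared: at interior nodes both sides are the difference expressions of
  the scheme, and off the interior both vanish, so imposing the scheme at interior nodes is the full
  operator equation.\<close>

lemma kinetic_step_iff:
  assumes A: "A \<in> H_h K" and B: "B \<in> H_h K" and f: "f \<in> H_h K"
  shows "kinetic_step hbar m0 hx hy K Vt dt f A B \<longleftrightarrow> step dt (lift f) (lift A) (lift B)"
proof -
  define M where "M = (\<lambda>j k. (B j k + A j k) / 2)"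
  define N where "N = (\<lambda>j k. (B j k - A j k) / complex_of_real dt)"
  have M_eq: "M = (\<lambda>j k. complex_of_real (1 / 2) * B j k + complex_of_real (1 / 2) * A j k)"
    by (simp add: M_def add_divide_distrib)
  have N_eq: "N = (\<lambda>j k. complex_of_real (1 / dt) * B j k + complex_of_real (- (1 / dt)) * A j k)"
    by (simp add: N_def diff_divide_distrib)
  have M: "M \<in> H_h K" "lift M = (1 / 2) *\<^sub>R (lift B + lift A)"
    unfolding M_eq lift_lincomb[OF B A] by (rule H_h_lincomb[OF B A], simp add: scaleR_right_distrib)
  have N: "N \<in> H_h K" "lift N = (1 / dt) *\<^sub>R (lift B - lift A)"
    unfolding N_eq lift_lincomb[OF B A] by (rule H_h_lincomb[OF B A], simp add: scaleR_right_diff_distrib)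
  define lhs where "lhs = hbar *\<^sub>R imag_op (S (lift N))"
  define rhs where "rhs = - (c_hbar hbar m0 *\<^sub>R D (lift M)) + S (mult_op w (lift M)) + lift f"
  have "coord lhs (j, k) = coord rhs (j, k) \<longleftrightarrow>
      \<i> * complex_of_real hbar * s_N hx hy N j k =
      - complex_of_real (c_hbar hbar m0) * Delta_hN hx hy M j k
      + s_N hx hy (\<lambda>j k. complex_of_real (Vt (real j * hx)) * M j k) j k + f j k"
    if jk: "(j, k) \<in> mesh_interior K" for j k
  proof -
    have "coord lhs (j, k) = \<i> * complex_of_real hbar * s_N hx hy N j k"
      using jk by (simp add: lhs_def coord_imag_op coord_S_lift[OF N(1)])
    moreover have "coord rhs (j, k) = - complex_of_real (c_hbar hbar m0) * Delta_hN hx hy M j k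
      + s_N hx hy (\<lambda>j k. complex_of_real (Vt (real j * hx)) * M j k) j k + f j k"
      unfolding rhs_def mult_w_lift(2)[OF M(1), symmetric]
      using jk by (simp add: coord_D_lift[OF M(1)] coord_S_lift[OF mult_w_lift(1)[OF M(1)]]
          coord_ell2_of_mesh[OF f])
    ultimately show ?thesis by simp
  qed
  moreover have outside: "coord lhs (j, k) = coord rhs (j, k)" if "(j, k) \<notin> mesh_interior K" for j k
    using that by (simp add: lhs_def rhs_def coord_imag_op S_def D_def coord_Dx coord_Dy coord_w w_apply
        coord_ell2_of_mesh f N(1))
  moreover have "lhs = rhs \<longleftrightarrow> (\<forall>(j, k) \<in> mesh_interior K. coord lhs (j, k) = coord rhs (j, k))"
  proof (intro iffI ell2_eqI)
    fix p assume "\<forall>(j, k) \<in> mesh_interior K. coord lhs (j, k) = coord rhs (j, k)"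
    then show "coord lhs p = coord rhs p"
      using outside by (cases p; cases "p \<in> mesh_interior K") auto
  qed auto
  ultimately have "lhs = rhs \<longleftrightarrow> (\<forall>(j, k) \<in> mesh_interior K.
      \<i> * complex_of_real hbar * s_N hx hy N j k =
      - complex_of_real (c_hbar hbar m0) * Delta_hN hx hy M j k
      + s_N hx hy (\<lambda>j k. complex_of_real (Vt (real j * hx)) * M j k) j k + f j k)"
    by fastforce
  then show ?thesis
    unfolding kinetic_step_def step_def lhs_def rhs_def M(2) N(2) by (simp only: M_def N_def)
qed

text \<open>The abstract solution is sought in all of \<open>ell2\<close>. Off the interior
  \<open>S\<close> is the identity and the remaining terms vanish, so the equation forces
  \<open>B\<close> to be zero there.\<close>

lemma step_supported:
  assumes "0 < dt" and "step dt (lift f) (lift A) B" and "A \<in> H_h K" "f \<in> H_h K"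
  shows "lift (mesh_of_ell2 K B) = B"
proof (rule ell2_eqI)
  fix p :: "nat \<times> nat"
  obtain j k where p: "p = (j, k)" by (cases p)
  have "coord B (j, k) = 0" if "(j, k) \<notin> mesh_interior K"
  proof -
    have "coord (hbar *\<^sub>R imag_op (S ((1 / dt) *\<^sub>R (B - lift A)))) (j, k) = 0"
      using assms(2) that unfolding step_def
      by (simp add: S_def D_def coord_Dx coord_Dy coord_w w_apply coord_ell2_of_mesh assms(3,4))
    then show ?thesis
      using that hbar assms(1) by (simp add: coord_imag_op S_def coord_Dx coord_Dy coord_ell2_of_mesh assms(3))
  qed
  then show "coord (lift (mesh_of_ell2 K B)) p = coord B p"
    unfolding p by (simp add: coord_ell2_of_mesh mesh_of_ell2_in_H_h) (simp add: mesh_of_ell2_def)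
qed

lemma kinetic_step_exists:
  assumes "0 < dt" "A \<in> H_h K" "f \<in> H_h K"
  shows "\<exists>B \<in> H_h K. kinetic_step hbar m0 hx hy K Vt dt f A B"
proof -
  obtain B where "step dt (lift f) (lift A) B"
    using ex1_step[OF assms(1)] by blast
  then show ?thesis
    using step_supported[of dt f A B] assms mesh_of_ell2_in_H_h[of K B] kinetic_step_iff by metis
qed

lemma kinetic_step_unique:
  assumes dt: "0 < dt" and A: "A \<in> H_h K" "A' \<in> H_h K" "mesh_eq K A A'" and f: "f \<in> H_h K"
    and B: "B \<in> H_h K" "kinetic_step hbar m0 hx hy K Vt dt f A B"
    and B': "B' \<in> H_h K" "kinetic_step hbar m0 hx hy K Vt dt f A' B'"
  shows "mesh_eq K B B'"
proof -
  have "step dt (lift f) (lift A) (lift B)" "step dt (lift f) (lift A) (lift B')"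
    using B B' kinetic_step_iff[OF A(1) B(1) f] kinetic_step_iff[OF A(2) B'(1) f]
      ell2_of_mesh_cong[OF A(3)] by simp_all
  then have "lift B = lift B'"
    using ex1_step[OF dt] by blast
  then show ?thesis
    using mesh_of_ell2_of_mesh[OF B(1)] mesh_of_ell2_of_mesh[OF B'(1)]
    by (metis (mono_tags, lifting) case_prodI2 mem_Collect_eq mesh_def mesh_eq_def case_prodD)
qed

lemma kinetic_step_norm:
  assumes "0 < dt" "A \<in> H_h K" "B \<in> H_h K" "f \<in> H_h K"
    and "kinetic_step hbar m0 hx hy K Vt dt f A B"
  shows "\<bar>H_norm hx hy K B - H_norm hx hy K A\<bar> \<le> 3 * dt / hbar * H_norm hx hy K f"
proof -
  have "\<bar>norm (lift B) - norm (lift A)\<bar> \<le> 3 * dt / hbar * norm (lift f)"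
    using assms by (intro norm_step) (simp_all add: kinetic_step_iff)
  then have "sqrt (hx * hy) * \<bar>norm (lift B) - norm (lift A)\<bar> \<le> sqrt (hx * hy) * (3 * dt / hbar * norm (lift f))"
    using hx hy by (intro mult_left_mono) auto
  moreover have "\<bar>H_norm hx hy K B - H_norm hx hy K A\<bar> = sqrt (hx * hy) * \<bar>norm (lift B) - norm (lift A)\<bar>"
    using hx hy assms by (simp add: H_norm_eq_norm abs_mult flip: right_diff_distrib)
  ultimately show ?thesis
    using hx hy assms by (simp add: H_norm_eq_norm mult_ac)
qed

end

section \<open>The splitting scheme\<close>

definition cayley :: "real \<Rightarrow> complex" where
  "cayley \<theta> = (1 - \<i> * complex_of_real \<theta>) / (1 + \<i> * complex_of_real \<theta>)"

lemma cayley_denominator: "1 + \<i> * complex_of_real \<theta> \<noteq> 0"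
  by (simp add: complex_eq_iff)

lemma cmod_cayley [simp]: "cmod (cayley \<theta>) = 1"
proof -
  have "cmod (1 - \<i> * complex_of_real \<theta>) = cmod (1 + \<i> * complex_of_real \<theta>)"
    by (simp add: cmod_def)
  then show ?thesis
    using cayley_denominator[of \<theta>] by (simp add: cayley_def norm_divide)
qed

text \<open>In the Cayley parameter one factor 1/2 comes from the half step and the other from the
  average. A common factor \<open>2 * hbar / dt\<close> is split off, leaving an equation linear in
  \<open>b\<close>.\<close>

lemma midpoint_eq_iff_cayley:
  assumes "0 < hbar" "0 < dt"
  shows "\<i> * complex_of_real hbar * ((b - a) / complex_of_real (dt / 2)) = complex_of_real v * ((b + a) / 2)
    \<longleftrightarrow> b = cayley (v * dt / (4 * hbar)) * a"
proof -
  define \<theta> where "\<theta> = v * dt / (4 * hbar)"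
  have v: "v = 4 * hbar * \<theta> / dt"
    using assms by (simp add: \<theta>_def)
  have "\<i> * complex_of_real hbar * ((b - a) / complex_of_real (dt / 2))
      = (2 * complex_of_real hbar / complex_of_real dt) * (\<i> * (b - a))"
    by simp
  moreover have "complex_of_real v * ((b + a) / 2)
      = (2 * complex_of_real hbar / complex_of_real dt) * (complex_of_real \<theta> * (b + a))"
    by (simp add: v)
  ultimately have "\<i> * complex_of_real hbar * ((b - a) / complex_of_real (dt / 2)) = complex_of_real v * ((b + a) / 2)
      \<longleftrightarrow> (2 * complex_of_real hbar / complex_of_real dt) * (\<i> * (b - a))
        = (2 * complex_of_real hbar / complex_of_real dt) * (complex_of_real \<theta> * (b + a))"
    by (simp only:)
  also have "\<dots> \<longleftrightarrow> \<i> * (b - a) = complex_of_real \<theta> * (b + a)"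
    using assms by simp
  also have "\<dots> \<longleftrightarrow> b * (1 + \<i> * complex_of_real \<theta>) = (1 - \<i> * complex_of_real \<theta>) * a"
  proof -
    \<comment> \<open>The two equations differ by the nonzero factor \<open>- \<i>\<close>.\<close>
    have "b * (1 + \<i> * complex_of_real \<theta>) - (1 - \<i> * complex_of_real \<theta>) * a
        = - \<i> * (\<i> * (b - a) - complex_of_real \<theta> * (b + a))"
      by (simp add: algebra_simps)
    then show ?thesis
      by (metis complex_i_not_zero eq_iff_diff_eq_0 mult_eq_0_iff neg_equal_0_iff_equal)
  qed
  also have "\<dots> \<longleftrightarrow> b = cayley \<theta> * a"
    using cayley_denominator[of \<theta>] by (simp add: cayley_def eq_divide_eq)
  finally show ?thesis by (simp add: \<theta>_def)
qed

definition potential_factor ::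
  "real \<Rightarrow> real \<Rightarrow> real \<Rightarrow> (real \<Rightarrow> real \<Rightarrow> real) \<Rightarrow> (real \<Rightarrow> real) \<Rightarrow> real \<Rightarrow> nat \<Rightarrow> nat \<Rightarrow> complex" where
  "potential_factor hbar hx hy V Vt dt j k =
     cayley ((V (real j * hx) (real k * hy) - Vt (real j * hx)) * dt / (4 * hbar))"

lemma potential_step_iff:
  assumes "0 < hbar" "0 < dt"
  shows "potential_step hbar hx hy K V Vt dt A B \<longleftrightarrow>
    (\<forall>(j, k) \<in> mesh_interior K. B j k = potential_factor hbar hx hy V Vt dt j k * A j k)"
  unfolding potential_step_def potential_factor_def midpoint_eq_iff_cayley[OF assms] ..

lemma cmod_potential_factor [simp]: "cmod (potential_factor hbar hx hy V Vt dt j k) = 1"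
  by (simp add: potential_factor_def)

lemma potential_step_cmod:
  assumes "0 < hbar" "0 < dt" "potential_step hbar hx hy K V Vt dt A B"
    and "(j, k) \<in> mesh_interior K"
  shows "cmod (B j k) = cmod (A j k)"
proof -
  have "B j k = potential_factor hbar hx hy V Vt dt j k * A j k"
    using assms(3,4) unfolding potential_step_iff[OF assms(1,2)] by blast
  then show ?thesis by (simp add: norm_mult)
qed

text \<open>With zero boundary values, membership depends only on moduli at interior nodes, so
  unimodular factors preserve it in both directions.\<close>

lemma H_h_cmod_cong:
  assumes "U \<in> H_h K" "zero_on_boundary K W"
    and "\<And>j k. (j, k) \<in> mesh_interior K \<Longrightarrow> cmod (W j k) = cmod (U j k)"
  shows "W \<in> H_h K"
proof -
  have "(\<lambda>j. \<Sum>k = 1..K - 1. (cmod (W j k))\<^sup>2) summable_on {1..}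
      \<longleftrightarrow> (\<lambda>j. \<Sum>k = 1..K - 1. (cmod (U j k))\<^sup>2) summable_on {1..}"
    by (intro summable_on_cong sum.cong) (auto simp: assms(3) mesh_interior_Times)
  with assms(1,2) show ?thesis by (simp add: H_h_def)
qed

lemma H_norm_cmod_cong:
  assumes "\<And>j k. (j, k) \<in> mesh_interior K \<Longrightarrow> cmod (W j k) = cmod (U j k)"
  shows "H_norm hx hy K W = H_norm hx hy K U"
  unfolding H_norm_def H_inner_def
  by (intro arg_cong[where f = "\<lambda>z. sqrt (Re z)"] infsum_cong sum.cong)
    (auto simp: assms mesh_interior_Times simp flip: complex_norm_square)

lemma mesh_eqI:
  assumes "zero_on_boundary K U" "zero_on_boundary K W"
    and "\<And>j k. (j, k) \<in> mesh_interior K \<Longrightarrow> U j k = W j k"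
  shows "mesh_eq K U W"
  using assms(3) zero_on_boundaryD[OF assms(1)] zero_on_boundaryD[OF assms(2)]
  unfolding mesh_eq_def mesh_def by (metis (mono_tags, lifting) case_prodD case_prodI2 mem_Collect_eq)

lemma potential_step_unique:
  assumes "0 < hbar" "0 < dt" and "mesh_eq K A A'"
    and B: "potential_step hbar hx hy K V Vt dt A B" "zero_on_boundary K B"
    and B': "potential_step hbar hx hy K V Vt dt A' B'" "zero_on_boundary K B'"
  shows "mesh_eq K B B'"
proof (rule mesh_eqI[OF B(2) B'(2)])
  fix j k assume jk: "(j, k) \<in> mesh_interior K"
  then have "A j k = A' j k"
    using assms(3) by (auto simp: mesh_eq_def mesh_def mesh_interior_def)
  moreover have "B j k = potential_factor hbar hx hy V Vt dt j k * A j k"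
    using B(1) jk unfolding potential_step_iff[OF assms(1,2)] by blast
  moreover have "B' j k = potential_factor hbar hx hy V Vt dt j k * A' j k"
    using B'(1) jk unfolding potential_step_iff[OF assms(1,2)] by blast
  ultimately show "B j k = B' j k" by simp
qed

lemma potential_step_exists:
  assumes "0 < hbar" "0 < dt" "A \<in> H_h K"
  shows "\<exists>B \<in> H_h K. potential_step hbar hx hy K V Vt dt A B"
proof
  let ?B = "\<lambda>j k. if (j, k) \<in> mesh_interior K
    then potential_factor hbar hx hy V Vt dt j k * A j k else 0"
  show "potential_step hbar hx hy K V Vt dt A ?B"
    unfolding potential_step_iff[OF assms(1,2)] by auto
  show "?B \<in> H_h K"
    by (rule H_h_cmod_cong[OF assms(3)])
      (auto simp: norm_mult zero_on_boundary_def mesh_boundary_def)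
qed

lemma tau_pos: "strict_mono t \<Longrightarrow> 1 \<le> m \<Longrightarrow> 0 < tau t m"
  by (simp add: tau_def strict_mono_less)

section \<open>One full splitting step\<close>

context numerov_mesh
begin

definition split_step ::
  "(real \<Rightarrow> real \<Rightarrow> real) \<Rightarrow> real \<Rightarrow> mesh_fun \<Rightarrow> mesh_fun \<Rightarrow> mesh_fun \<Rightarrow> mesh_fun \<Rightarrow> mesh_fun \<Rightarrow> bool" where
  "split_step V dt f A Ab At C \<longleftrightarrow>
     potential_step hbar hx hy K V Vt dt A Ab \<and> kinetic_step hbar m0 hx hy K Vt dt f Ab At \<and>
     potential_step hbar hx hy K V Vt dt At C \<and>
     zero_on_boundary K Ab \<and> zero_on_boundary K At \<and> zero_on_boundary K C"

lemma splitting_scheme_iff: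
  "splitting_scheme hbar m0 hx hy K V Vt t F P0 Pb Pt P \<longleftrightarrow>
     (\<forall>m\<ge>1. split_step V (tau t m) (F m) (P (m - 1)) (Pb m) (Pt m) (P m)) \<and> mesh_eq K (P 0) P0"
  by (simp add: splitting_scheme_def split_step_def)

context
  fixes dt :: real and f :: mesh_fun
  assumes dt: "0 < dt" and f: "f \<in> H_h K"
begin

lemma split_step_exists:
  assumes "A \<in> H_h K"
  shows "\<exists>Ab At C. split_step V dt f A Ab At C \<and> C \<in> H_h K"
  using potential_step_exists[OF hbar dt] kinetic_step_exists[OF dt _ f] assms H_h_boundary
  unfolding split_step_def by meson

text \<open>The uniqueness class constrains only the plain values. The intermediate ones are
  recovered from them: \<open>Ab\<close> forward from \<open>A\<close>, and \<open>At\<close>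
  backward from \<open>C\<close>, as the half steps preserve moduli.\<close>

lemma split_step_in_H_h:
  assumes "split_step V dt f A Ab At C" "A \<in> H_h K" "C \<in> H_h K"
  shows "Ab \<in> H_h K" and "At \<in> H_h K"
proof -
  show "Ab \<in> H_h K"
    by (rule H_h_cmod_cong[OF assms(2)])
      (use assms(1) potential_step_cmod[OF hbar dt] in \<open>auto simp: split_step_def\<close>)
  show "At \<in> H_h K"
    by (rule H_h_cmod_cong[OF assms(3)])
      (use assms(1) potential_step_cmod[OF hbar dt, symmetric] in \<open>auto simp: split_step_def\<close>)
qed

text \<open>Both half steps preserve the norm, so the whole change comes from the kinetic
  step.\<close>

lemma split_step_norm:
  assumes step: "split_step V dt f A Ab At C" and "A \<in> H_h K" "C \<in> H_h K"
  shows "\<bar>H_norm hx hy K C - H_norm hx hy K A\<bar> \<le> 3 * dt / hbar * H_norm hx hy K f"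
proof -
  have "H_norm hx hy K Ab = H_norm hx hy K A"
    by (rule H_norm_cmod_cong)
      (use step potential_step_cmod[OF hbar dt] in \<open>auto simp: split_step_def\<close>)
  moreover have "H_norm hx hy K C = H_norm hx hy K At"
    by (rule H_norm_cmod_cong)
      (use step potential_step_cmod[OF hbar dt] in \<open>auto simp: split_step_def\<close>)
  moreover have "\<bar>H_norm hx hy K At - H_norm hx hy K Ab\<bar> \<le> 3 * dt / hbar * H_norm hx hy K f"
    using step by (intro kinetic_step_norm[OF dt _ _ f] split_step_in_H_h[OF assms])
      (simp add: split_step_def)
  ultimately show ?thesis by simp
qed

lemma split_step_unique:
  assumes A: "mesh_eq K A A'"
    and 1: "split_step V dt f A Ab At C" "A \<in> H_h K" "C \<in> H_h K"
    and 2: "split_step V dt f A' Ab' At' C'" "A' \<in> H_h K" "C' \<in> H_h K"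
  shows "mesh_eq K Ab Ab'" and "mesh_eq K At At'" and "mesh_eq K C C'"
proof -
  show Ab: "mesh_eq K Ab Ab'"
    using 1(1) 2(1) by (intro potential_step_unique[OF hbar dt A]) (auto simp: split_step_def)
  show At: "mesh_eq K At At'"
    using kinetic_step_unique[OF dt _ _ Ab f] split_step_in_H_h[OF 1] split_step_in_H_h[OF 2] 1(1) 2(1)
    by (auto simp: split_step_def)
  show "mesh_eq K C C'"
    using 1(1) 2(1) by (intro potential_step_unique[OF hbar dt At]) (auto simp: split_step_def)
qed

end

section \<open>The evolution over all time levels\<close>

context
  fixes V :: "real \<Rightarrow> real \<Rightarrow> real" and t :: "nat \<Rightarrow> real" and F :: "nat \<Rightarrow> mesh_fun" and P0 :: mesh_fun
  assumes t: "strict_mono t" and F: "\<And>m. 1 \<le> m \<Longrightarrow> F m \<in> H_h K"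
begin

text \<open>Dependent choice on triples whose last component is the plain value; the first two are
  arbitrary at level 0. The initial value is \<open>P0\<close> itself and not merely
  \<open>mesh_eq\<close> to it, which starts the norm inductions below.\<close>

lemma splitting_scheme_exists:
  assumes "P0 \<in> H_h K"
  shows "\<exists>Pb Pt P. splitting_scheme hbar m0 hx hy K V Vt t F P0 Pb Pt P \<and> P 0 = P0 \<and> (\<forall>m. P m \<in> H_h K)"
proof -
  have "\<exists>g. \<forall>m. (snd (snd (g m)) \<in> H_h K \<and> (m = 0 \<longrightarrow> snd (snd (g m)) = P0)) \<and>
      split_step V (tau t (Suc m)) (F (Suc m)) (snd (snd (g m)))
        (fst (g (Suc m))) (fst (snd (g (Suc m)))) (snd (snd (g (Suc m))))"
  proof (rule dependent_nat_choice)
    show "\<exists>x :: mesh_fun \<times> mesh_fun \<times> mesh_fun. snd (snd x) \<in> H_h K \<and> (0 = (0::nat) \<longrightarrow> snd (snd x) = P0)"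
      using assms by auto
    fix x :: "mesh_fun \<times> mesh_fun \<times> mesh_fun" and m :: nat
    assume "snd (snd x) \<in> H_h K \<and> (m = 0 \<longrightarrow> snd (snd x) = P0)"
    then obtain Ab At C where
      "split_step V (tau t (Suc m)) (F (Suc m)) (snd (snd x)) Ab At C" "C \<in> H_h K"
      using split_step_exists[OF tau_pos[OF t, of "Suc m"] F[of "Suc m"],
          where A = "snd (snd x)" and V = V] by auto
    then show "\<exists>y. (snd (snd y) \<in> H_h K \<and> (Suc m = 0 \<longrightarrow> snd (snd y) = P0)) \<and>
        split_step V (tau t (Suc m)) (F (Suc m)) (snd (snd x)) (fst y) (fst (snd y)) (snd (snd y))"
      by (intro exI[of _ "(Ab, At, C)"]) simp
  qed
  then obtain g where g: "\<And>m. snd (snd (g m)) \<in> H_h K" "snd (snd (g 0)) = P0"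
    "\<And>m. split_step V (tau t (Suc m)) (F (Suc m)) (snd (snd (g m)))
        (fst (g (Suc m))) (fst (snd (g (Suc m)))) (snd (snd (g (Suc m))))"
    by blast
  have "split_step V (tau t m) (F m) (snd (snd (g (m - 1)))) (fst (g m)) (fst (snd (g m))) (snd (snd (g m)))"
    if "1 \<le> m" for m
    using g(3)[of "m - 1"] that by simp
  then have "splitting_scheme hbar m0 hx hy K V Vt t F P0
      (\<lambda>m. fst (g m)) (\<lambda>m. fst (snd (g m))) (\<lambda>m. snd (snd (g m)))"
    unfolding splitting_scheme_iff using g(2) by (auto simp: mesh_eq_def)
  then show ?thesis
    using g(1,2) by blast
qed

lemma splitting_scheme_unique:
  assumes s: "splitting_scheme hbar m0 hx hy K V Vt t F P0 Pb Pt P" "\<And>m. P m \<in> H_h K"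
    and s': "splitting_scheme hbar m0 hx hy K V Vt t F P0 Pb' Pt' P'" "\<And>m. P' m \<in> H_h K"
  shows "mesh_eq K (P' m) (P m)"
    and "1 \<le> m \<Longrightarrow> mesh_eq K (Pb' m) (Pb m)" and "1 \<le> m \<Longrightarrow> mesh_eq K (Pt' m) (Pt m)"
proof -
  have step: "split_step V (tau t m) (F m) (P (m - 1)) (Pb m) (Pt m) (P m)"
    "split_step V (tau t m) (F m) (P' (m - 1)) (Pb' m) (Pt' m) (P' m)" if "1 \<le> m" for m
    using s(1) s'(1) that unfolding splitting_scheme_iff by blast+
  show P: "mesh_eq K (P' m) (P m)" for m
  proof (induction m)
    case 0
    show ?case
      using s(1) s'(1) unfolding splitting_scheme_iff mesh_eq_def by fastforce
  next
    case (Suc m)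
    then have "mesh_eq K (P' (Suc m - 1)) (P (Suc m - 1))"
      by simp
    from split_step_unique(3)[OF tau_pos[OF t, of "Suc m"] F[of "Suc m"] this
        step(2)[of "Suc m"] s'(2) s'(2) step(1)[of "Suc m"] s(2) s(2)]
    show ?case by simp
  qed
  show "mesh_eq K (Pb' m) (Pb m)" "mesh_eq K (Pt' m) (Pt m)" if m: "1 \<le> m"
    using split_step_unique(1,2)[OF tau_pos[OF t m] F[OF m] P step(2)[OF m] s'(2) s'(2) step(1)[OF m] s(2) s(2)]
    by simp_all
qed

lemma splitting_scheme_norm_step:
  assumes s: "splitting_scheme hbar m0 hx hy K V Vt t F P0 Pb Pt P" "\<And>m. P m \<in> H_h K" and m: "1 \<le> m"
  shows "\<bar>H_norm hx hy K (P m) - H_norm hx hy K (P (m - 1))\<bar> \<le> 3 * tau t m / hbar * H_norm hx hy K (F m)"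
  using s(1) m unfolding splitting_scheme_iff
  by (intro split_step_norm[OF tau_pos[OF t m] F[OF m] _ s(2) s(2)]) blast

text \<open>Telescopes the upper half of the step estimate.\<close>

lemma splitting_scheme_stable:
  assumes s: "splitting_scheme hbar m0 hx hy K V Vt t F P0 Pb Pt P" "\<And>m. P m \<in> H_h K" and "P 0 = P0"
  shows "H_norm hx hy K (P m)
    \<le> H_norm hx hy K P0 + 3 / hbar * (\<Sum>i = 1..m. H_norm hx hy K (F i) * tau t i)"
proof (induction m)
  case (Suc m)
  have "H_norm hx hy K (P (Suc m)) \<le> H_norm hx hy K (P m) + 3 / hbar * (H_norm hx hy K (F (Suc m)) * tau t (Suc m))"
    using splitting_scheme_norm_step[OF s, of "Suc m"] by (simp add: mult_ac)
  with Suc show ?case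
    by (simp add: distrib_left)
qed (use assms in simp)

text \<open>With vanishing source the two-sided step estimate has right-hand side zero, which forces
  equal norms.\<close>

lemma splitting_scheme_conserves:
  assumes s: "splitting_scheme hbar m0 hx hy K V Vt t F P0 Pb Pt P" "\<And>m. P m \<in> H_h K" and "P 0 = P0"
    and "\<And>m. 1 \<le> m \<Longrightarrow> mesh_eq K (F m) (\<lambda>j k. 0)"
  shows "H_norm hx hy K (P m) = H_norm hx hy K P0"
proof (induction m)
  case (Suc m)
  have "H_norm hx hy K (F (Suc m)) = H_norm hx hy K (\<lambda>j k. 0)"
    using assms(4)[of "Suc m"]
    by (intro H_norm_cmod_cong) (auto simp: mesh_eq_def mesh_def mesh_interior_def)
  also have "\<dots> = 0"
    by (simp add: H_norm_def H_inner_def)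
  finally show ?case
    using Suc splitting_scheme_norm_step[OF s, of "Suc m"] by simp
qed (use assms in simp)

end

lemma H_norm_nonneg: "U \<in> H_h K \<Longrightarrow> 0 \<le> H_norm hx hy K U"
  using hx hy by (simp add: H_norm_eq_norm)

end

text \<open>Only finitely many mesh points lie before \<open>X0\<close>, and the sum of the moduli
  there dominates each of them. On the interval itself \<open>g\<close> may be unbounded, so the
  claim concerns mesh values only.\<close>

lemma mesh_values_bounded:
  fixes g :: "real \<Rightarrow> real"
  assumes "0 < h" and const: "\<And>x. X0 \<le> x \<Longrightarrow> g x = c"
  shows "\<exists>B. \<forall>j. \<bar>g (real j * h)\<bar> \<le> B"
proof -
  obtain N where N: "X0 < real N * h"
    using reals_Archimedean3[OF assms(1)] by blast
  have "\<bar>g (real j * h)\<bar> \<le> \<bar>c\<bar> + (\<Sum>i<N. \<bar>g (real i * h)\<bar>)" for j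
  proof (cases "j < N")
    case True
    then have "\<bar>g (real j * h)\<bar> \<le> (\<Sum>i<N. \<bar>g (real i * h)\<bar>)"
      by (intro member_le_sum) auto
    then show ?thesis by simp
  next
    case False
    then have "real N * h \<le> real j * h"
      using assms(1) by simp
    then have "g (real j * h) = c"
      using N by (intro const) simp
    then show ?thesis by (simp add: sum_nonneg)
  qed
  then show ?thesis by blast
qed

theorem proposition1:
  fixes hbar m0 X X0 Y Vinf hx hy :: real
    and J K :: nat
    and V :: "real \<Rightarrow> real \<Rightarrow> real"
    and Vt :: "real \<Rightarrow> real"
    and t :: "nat \<Rightarrow> real"
    and F :: "nat \<Rightarrow> mesh_fun"
    and P0 :: mesh_fun
  assumes "hbar > 0" and "m0 > 0"
    and "Y > 0" and "X0 > 0" and "X > X0"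
    and "J \<ge> 1" and "K \<ge> 1"
    and "hx = X / real J" and "hy = Y / real K" and "hx \<le> X - X0"
    and "\<And>x y. x \<ge> X0 \<Longrightarrow> 0 < y \<Longrightarrow> y < Y \<Longrightarrow> V x y = Vinf"
    and "\<And>x. x \<ge> X0 \<Longrightarrow> Vt x = Vinf"
    and "t 0 = 0" and "strict_mono t" and "filterlim t at_top sequentially"
    and "P0 \<in> H_h K" and "\<And>m. m \<ge> 1 \<Longrightarrow> F m \<in> H_h K"
  shows "\<exists>Pb Pt P.
      splitting_scheme hbar m0 hx hy K V Vt t F P0 Pb Pt P \<and> (\<forall>m. P m \<in> H_h K) \<and>
      (\<forall>Pb' Pt' P'.
          splitting_scheme hbar m0 hx hy K V Vt t F P0 Pb' Pt' P' \<and> (\<forall>m. P' m \<in> H_h K) \<longrightarrow>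
          (\<forall>m. mesh_eq K (P' m) (P m)) \<and>
          (\<forall>m\<ge>1. mesh_eq K (Pb' m) (Pb m) \<and> mesh_eq K (Pt' m) (Pt m))) \<and>
      (\<forall>M\<ge>1. (MAX m\<in>{0..M}. H_norm hx hy K (P m))
              \<le> H_norm hx hy K P0 + 6 / hbar * (\<Sum>m = 1..M. H_norm hx hy K (F m) * tau t m)) \<and>
      ((\<forall>m\<ge>1. mesh_eq K (F m) (\<lambda>j k. 0)) \<longrightarrow>
          (\<forall>m\<ge>1. (H_norm hx hy K (P m))\<^sup>2 = (H_norm hx hy K P0)\<^sup>2))"
proof -
  have h: "0 < hx" "0 < hy"
    using assms by simp_all
  obtain B where B: "\<And>j. \<bar>Vt (real j * hx)\<bar> \<le> B"
    using mesh_values_bounded[of hx X0 Vt Vinf] h assms(12) by blast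
  interpret numerov_mesh hbar m0 hx hy B K Vt
    using h B assms(1) by unfold_locales
  obtain Pb Pt P where s: "splitting_scheme hbar m0 hx hy K V Vt t F P0 Pb Pt P"
    and P: "P 0 = P0" "\<And>m. P m \<in> H_h K"
    using splitting_scheme_exists[where F = F, OF assms(14,17,16)] by blast
  have nonneg: "0 \<le> H_norm hx hy K (F i) * tau t i" if "1 \<le> i" for i
    using H_norm_nonneg[OF assms(17)[OF that]] tau_pos[OF assms(14) that] by simp
  have "(MAX m\<in>{0..M}. H_norm hx hy K (P m))
      \<le> H_norm hx hy K P0 + 6 / hbar * (\<Sum>m = 1..M. H_norm hx hy K (F m) * tau t m)" for M
  proof -
    have "H_norm hx hy K (P m) \<le> H_norm hx hy K P0 + 6 / hbar * (\<Sum>m = 1..M. H_norm hx hy K (F m) * tau t m)"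
      if "m \<le> M" for m
    proof -
      \<comment> \<open>The sum grows when extended from \<open>m\<close> to \<open>M\<close>
        because its terms are nonnegative, and the constant 3 is relaxed to 6.\<close>
      have "3 / hbar * (\<Sum>i = 1..m. H_norm hx hy K (F i) * tau t i)
          \<le> 6 / hbar * (\<Sum>i = 1..M. H_norm hx hy K (F i) * tau t i)"
        using that nonneg assms(1)
        by (intro mult_mono sum_mono2 sum_nonneg divide_right_mono) auto
      then show ?thesis
        using splitting_scheme_stable[where F = F, OF assms(14,17) s P(2,1), of m] by linarith
    qed
    then show ?thesis
      by (intro Max.boundedI) auto
  qed
  moreover have "(H_norm hx hy K (P m))\<^sup>2 = (H_norm hx hy K P0)\<^sup>2"
    if "\<forall>m\<ge>1. mesh_eq K (F m) (\<lambda>j k. 0)" for m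
    using splitting_scheme_conserves[where F = F, OF assms(14,17) s P(2,1), of m] that by simp
  moreover have "(\<forall>m. mesh_eq K (P' m) (P m)) \<and>
      (\<forall>m\<ge>1. mesh_eq K (Pb' m) (Pb m) \<and> mesh_eq K (Pt' m) (Pt m))"
    if "splitting_scheme hbar m0 hx hy K V Vt t F P0 Pb' Pt' P' \<and> (\<forall>m. P' m \<in> H_h K)" for Pb' Pt' P'
    using splitting_scheme_unique[where F = F, OF assms(14,17) s P(2), of Pb' Pt' P'] that by blast
  ultimately show ?thesis
    using s P(2) by (intro exI[of _ Pb] exI[of _ Pt] exI[of _ P]) blast
qed

end
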